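(* Let $K=\mathbb{F}_q$, $S=K[t_1,\ldots,t_s]$, and let $\mathcal{X}=[A_1\times\cdots\times A_s]\subset\mathbb{P}^{s-1}$ be a projective nested cartesian set with $d_i=|A_i|$. Let $\prec$ be the lexicographical order with $t_1\prec\cdots\prec t_s$. If $0\neq f\in S_d$ is a standard polynomial of $S/I(\mathcal{X})$ with $1\leq d\leq\sum_{i=2}^s(d_i-1)$ and $t_1$ divides $\mathrm{in}_\prec(f)$, then $$|V_{\mathcal{X}}(f)|\leq\deg(S/I(\mathcal{X}))-(d_{k+2}-\ell+1)d_{k+3}\cdots d_s,$$ where $0\leq k\leq s-2$ and $\ell$ are the integers with $d=\sum_{i=2}^{k+1}(d_i-1)+\ell$ and $1\leq\ell\leq d_{k+2}-1$.
   Context: Projective nested cartesian set: for subsets $A_1,\ldots,A_s$ of $K$, $\mathcal{X}=[A_1\times\cdots\times A_s]$ is the image of $(A_1\times\cdots\times A_s)\setminus\{0\}$ under $K^s\setminus\{0\}\to\mathbb{P}^{s-1}$, $x\mapsto[x]$, and it is required that (i) $\{0,1\}\subset A_i$ for all $i$; (ii) $a/b\in A_j$ whenever $1\leq i<j\leq s$, $a\in A_j$, $0\neq b\in A_i$; (iii) $d_1\leq\cdots\leq d_s$ where $d_i=|A_i|$. $I(\mathcal{X})$ is the ideal generated by the homogeneous polynomials vanishing on $\mathcal{X}$; $V_{\mathcal{X}}(f)$ is the set of zeros of $f$ in $\mathcal{X}$. $\mathrm{in}_\prec(f)$ is the leading monomial. A standard polynomial is a nonzero $K$-linear combination of monomials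 not in the initial ideal $\mathrm{in}_\prec(I(\mathcal{X}))$. For a graded ideal $J$ with Hilbert function $H_J(d)=\dim_K(S_d/J_d)$ and $k=\dim(S/J)$, $\deg(S/J)=(k-1)!\lim_{d\to\infty}H_J(d)/d^{k-1}$ if $k\geq1$ and $\dim_K(S/J)$ if $k=0$. *)

theory Defs
  imports Complex_Main "HOL-Library.Poly_Mapping"
begin

text \<open>Multivariate polynomials over a field 'a in the variables t_i, i :: nat.
  A monomial is an exponent vector (exponent vector); a polynomial maps monomials to
  coefficients. The ring S = K[t_1,...,t_s] consists of the polynomials whose
  monomials only involve the variables t_1, ..., t_s (indices 1..s).\<close>

type_synonym 'a mpoly = "(nat \<Rightarrow>\<^sub>0 nat) \<Rightarrow>\<^sub>0 'a"

definition mon_deg :: "(nat \<Rightarrow>\<^sub>0 nat) \<Rightarrow> nat" where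
  "mon_deg m = (\<Sum>i\<in>Poly_Mapping.keys m. Poly_Mapping.lookup m i)"

definition polyS :: "nat \<Rightarrow> 'a::field mpoly set" where
  "polyS s = {f. \<forall>m\<in>Poly_Mapping.keys f. Poly_Mapping.keys m \<subseteq> {1..s}}"

definition homog :: "nat \<Rightarrow> nat \<Rightarrow> 'a::field mpoly set" where
  "homog s d = {f \<in> polyS s. \<forall>m\<in>Poly_Mapping.keys f. mon_deg m = d}"

definition const_poly :: "'a::field \<Rightarrow> 'a mpoly" where
  "const_poly c = Poly_Mapping.single 0 c"

definition mon_poly :: "(nat \<Rightarrow>\<^sub>0 nat) \<Rightarrow> 'a::field mpoly" where
  "mon_poly m = Poly_Mapping.single m 1"

definition peval :: "'a::field mpoly \<Rightarrow> (nat \<Rightarrow> 'a) \<Rightarrow> 'a" where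
  "peval f x = (\<Sum>m\<in>Poly_Mapping.keys f. Poly_Mapping.lookup f m * (\<Prod>i\<in>Poly_Mapping.keys m. x i ^ Poly_Mapping.lookup m i))"

inductive_set ideal_gen :: "nat \<Rightarrow> 'a::field mpoly set \<Rightarrow> 'a mpoly set"
  for s :: nat and G :: "'a mpoly set" where
  zero: "0 \<in> ideal_gen s G"
| gen: "g \<in> G \<Longrightarrow> g \<in> ideal_gen s G"
| add: "a \<in> ideal_gen s G \<Longrightarrow> b \<in> ideal_gen s G \<Longrightarrow> a + b \<in> ideal_gen s G"
| mult: "h \<in> polyS s \<Longrightarrow> a \<in> ideal_gen s G \<Longrightarrow> h * a \<in> ideal_gen s G"

definition affine_cart :: "nat \<Rightarrow> (nat \<Rightarrow> 'a::field set) \<Rightarrow> (nat \<Rightarrow> 'a) set" where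
  "affine_cart s A = {x. (\<forall>i\<in>{1..s}. x i \<in> A i) \<and> (\<forall>i. i \<notin> {1..s} \<longrightarrow> x i = 0)}"

definition proj_pt :: "(nat \<Rightarrow> 'a::field) \<Rightarrow> (nat \<Rightarrow> 'a) set" where
  "proj_pt x = {(\<lambda>i. c * x i) | c. c \<noteq> 0}"

definition proj_cart :: "nat \<Rightarrow> (nat \<Rightarrow> 'a::field set) \<Rightarrow> (nat \<Rightarrow> 'a) set set" where
  "proj_cart s A = proj_pt ` (affine_cart s A - {(\<lambda>_. 0)})"

definition nested_cartesian :: "nat \<Rightarrow> (nat \<Rightarrow> 'a::field set) \<Rightarrow> bool" where
  "nested_cartesian s A \<longleftrightarrow>
     (\<forall>i\<in>{1..s}. finite (A i) \<and> {0, 1} \<subseteq> A i) \<and>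
     (\<forall>i j a b. 1 \<le> i \<and> i < j \<and> j \<le> s \<and> a \<in> A j \<and> b \<in> A i \<and> b \<noteq> 0 \<longrightarrow> a / b \<in> A j) \<and>
     (\<forall>i j. 1 \<le> i \<and> i \<le> j \<and> j \<le> s \<longrightarrow> card (A i) \<le> card (A j))"

definition zeros_in :: "'a::field mpoly \<Rightarrow> (nat \<Rightarrow> 'a) set set \<Rightarrow> (nat \<Rightarrow> 'a) set set" where
  "zeros_in f X = {P \<in> X. \<forall>x\<in>P. peval f x = 0}"

definition vanishing_ideal :: "nat \<Rightarrow> (nat \<Rightarrow> 'a::field) set set \<Rightarrow> 'a mpoly set" where
  "vanishing_ideal s X =
     ideal_gen s {f. (\<exists>d. f \<in> homog s d) \<and> (\<forall>P\<in>X. \<forall>x\<in>P. peval f x = 0)}"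

definition lex_less :: "(nat \<Rightarrow>\<^sub>0 nat) \<Rightarrow> (nat \<Rightarrow>\<^sub>0 nat) \<Rightarrow> bool" where
  "lex_less m m' \<longleftrightarrow> (\<exists>i. Poly_Mapping.lookup m i < Poly_Mapping.lookup m' i \<and> (\<forall>j>i. Poly_Mapping.lookup m j = Poly_Mapping.lookup m' j))"

definition lead_mon :: "'a::field mpoly \<Rightarrow> (nat \<Rightarrow>\<^sub>0 nat)" where
  "lead_mon f = (THE m. m \<in> Poly_Mapping.keys f \<and> (\<forall>m'\<in>Poly_Mapping.keys f. m' \<noteq> m \<longrightarrow> lex_less m' m))"

definition initial_ideal :: "nat \<Rightarrow> 'a::field mpoly set \<Rightarrow> 'a mpoly set" where
  "initial_ideal s I = ideal_gen s {mon_poly (lead_mon g) | g. g \<in> I \<and> g \<noteq> 0}"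

definition standard_poly :: "nat \<Rightarrow> 'a::field mpoly set \<Rightarrow> 'a mpoly \<Rightarrow> bool" where
  "standard_poly s I f \<longleftrightarrow> f \<noteq> 0 \<and> (\<forall>m\<in>Poly_Mapping.keys f. mon_poly m \<notin> (initial_ideal s I :: 'a mpoly set))"

definition lin_indep_mod :: "'a::field mpoly set \<Rightarrow> 'a mpoly set \<Rightarrow> bool" where
  "lin_indep_mod J B \<longleftrightarrow> finite B \<and>
     (\<forall>c. (\<Sum>b\<in>B. const_poly (c b) * b) \<in> J \<longrightarrow> (\<forall>b\<in>B. c b = 0))"

definition hilbert_fun :: "nat \<Rightarrow> 'a::field mpoly set \<Rightarrow> nat \<Rightarrow> nat" where
  "hilbert_fun s J d = Sup {card B | B. B \<subseteq> homog s d \<and> lin_indep_mod (J \<inter> homog s d) B}"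

definition quot_dim :: "nat \<Rightarrow> 'a::field mpoly set \<Rightarrow> nat" where
  "quot_dim s J = Sup {card B | B. B \<subseteq> polyS s \<and> lin_indep_mod J B}"

definition is_ideal :: "nat \<Rightarrow> 'a::field mpoly set \<Rightarrow> bool" where
  "is_ideal s P \<longleftrightarrow> P \<subseteq> polyS s \<and> 0 \<in> P \<and> (\<forall>a\<in>P. \<forall>b\<in>P. a + b \<in> P) \<and>
     (\<forall>h\<in>polyS s. \<forall>a\<in>P. h * a \<in> P)"

definition is_prime_ideal :: "nat \<Rightarrow> 'a::field mpoly set \<Rightarrow> bool" where
  "is_prime_ideal s P \<longleftrightarrow> is_ideal s P \<and> P \<noteq> polyS s \<and>
     (\<forall>f\<in>polyS s. \<forall>g\<in>polyS s. f * g \<in> P \<longrightarrow> f \<in> P \<or> g \<in> P)"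

definition krull_dim :: "nat \<Rightarrow> 'a::field mpoly set \<Rightarrow> nat" where
  "krull_dim s J = Sup {n. \<exists>Ps :: 'a mpoly set list. length Ps = Suc n \<and>
      (\<forall>P\<in>set Ps. is_prime_ideal s P \<and> J \<subseteq> P) \<and>
      (\<forall>i<n. Ps ! i \<subset> Ps ! Suc i)}"

definition deg_quot :: "nat \<Rightarrow> 'a::field mpoly set \<Rightarrow> real" where
  "deg_quot s J = (let k = krull_dim s J in
     if k \<ge> 1 then fact (k - 1) * lim (\<lambda>d. real (hilbert_fun s J d) / real d ^ (k - 1))
     else real (quot_dim s J))"

end

theory Submission
  imports Defs "HOL-Computational_Algebra.Polynomial" "HOL-Library.FuncSet"
begin

text \<open>The ideal \<open>I(X)\<close> is the intersection of the kernels of the substitutions \<open>t\<^sub>i \<mapsto> x\<^sub>i t\<close>, one for each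
  point of \<open>X\<close>. Hence \<open>S/I(X)\<close> has Krull dimension 1, its Hilbert function is eventually \<open>|X|\<close>, and
  \<open>deg (S/I(X)) = |X|\<close>; the claim is a lower bound for the number of points of \<open>X\<close> where \<open>f\<close> does not
  vanish. Such points are already found on the affine grid \<open>t\<^sub>1 = 1\<close>: let \<open>a\<close> be the exponent of
  the leading monomial of \<open>f\<close>. Dehomogenizing keeps the lexicographic order among
  monomials of degree \<open>d\<close>, so there are at least \<open>\<Prod>\<^sub>j\<^sub>\<ge>\<^sub>2 (d\<^sub>j - a\<^sub>j)\<close> such points. As \<open>t\<^sub>1\<close> divides the
  leading monomial and \<open>f\<close> is standard, \<open>a\<^sub>j < d\<^sub>j\<close> and \<open>\<Sum>\<^sub>j\<^sub>\<ge>\<^sub>2 a\<^sub>j \<le> d - 1\<close>, and under these constraints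
  the product is least when the \<open>a\<^sub>j\<close> with small \<open>j\<close> are as large as possible.\<close>

subsection \<open>Evaluation of polynomials\<close>

definition mon_val :: "(nat \<Rightarrow> 'a::field) \<Rightarrow> (nat \<Rightarrow>\<^sub>0 nat) \<Rightarrow> 'a" where
  "mon_val x m = (\<Prod>i\<in>Poly_Mapping.keys m. x i ^ Poly_Mapping.lookup m i)"

lemma mon_val_superset:
  "finite I \<Longrightarrow> Poly_Mapping.keys m \<subseteq> I \<Longrightarrow> mon_val x m = (\<Prod>i\<in>I. x i ^ Poly_Mapping.lookup m i)"
  unfolding mon_val_def by (rule prod.mono_neutral_left) (auto simp: in_keys_iff)

lemma mon_deg_superset:
  "finite I \<Longrightarrow> Poly_Mapping.keys m \<subseteq> I \<Longrightarrow> mon_deg m = (\<Sum>i\<in>I. Poly_Mapping.lookup m i)"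
  unfolding mon_deg_def by (rule sum.mono_neutral_left) (auto simp: in_keys_iff)

lemma mon_val_add: "mon_val x (m + n) = mon_val x m * mon_val x n"
proof -
  let ?I = "Poly_Mapping.keys m \<union> Poly_Mapping.keys n"
  have "Poly_Mapping.keys (m + n) \<subseteq> ?I" by (rule keys_add)
  then show ?thesis
    by (simp add: mon_val_superset[of ?I] lookup_add power_add prod.distrib)
qed

lemma mon_deg_add: "mon_deg (m + n) = mon_deg m + mon_deg n"
proof -
  let ?I = "Poly_Mapping.keys m \<union> Poly_Mapping.keys n"
  have "Poly_Mapping.keys (m + n) \<subseteq> ?I" by (rule keys_add)
  then show ?thesis
    by (simp add: mon_deg_superset[of ?I] lookup_add sum.distrib)
qed

lemma mon_val_single [simp]: "mon_val x (Poly_Mapping.single i n) = x i ^ n"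
  by (cases "n = 0") (simp_all add: mon_val_def)

lemma mon_deg_single [simp]: "mon_deg (Poly_Mapping.single i n) = n"
  by (cases "n = 0") (simp_all add: mon_deg_def)

lemma mon_val_zero [simp]: "mon_val x 0 = 1"
  by (simp add: mon_val_def)

lemma mon_deg_zero [simp]: "mon_deg 0 = 0"
  by (simp add: mon_deg_def)

lemma mon_val_scale: "mon_val (\<lambda>i. c * x i) m = c ^ mon_deg m * mon_val x m"
  by (simp add: mon_val_def mon_deg_def power_mult_distrib prod.distrib power_sum)

lemma peval_eq: "peval f x = (\<Sum>m\<in>Poly_Mapping.keys f. Poly_Mapping.lookup f m * mon_val x m)"
  by (simp add: peval_def mon_val_def)

text \<open>The substitution \<open>t\<^sub>i \<mapsto> x\<^sub>i t\<close>. Its kernel is the ideal of the projective point \<open>[x]\<close>, and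
  its value at \<open>t = 1\<close> is evaluation at \<open>x\<close>.\<close>

definition line_restr :: "(nat \<Rightarrow> 'a::field) \<Rightarrow> 'a mpoly \<Rightarrow> 'a poly" where
  "line_restr x f =
     (\<Sum>m\<in>Poly_Mapping.keys f. monom (Poly_Mapping.lookup f m * mon_val x m) (mon_deg m))"

lemma line_restr_superset:
  "finite M \<Longrightarrow> Poly_Mapping.keys f \<subseteq> M \<Longrightarrow>
   line_restr x f = (\<Sum>m\<in>M. monom (Poly_Mapping.lookup f m * mon_val x m) (mon_deg m))"
  unfolding line_restr_def by (rule sum.mono_neutral_left) (auto simp: in_keys_iff)

lemma line_restr_zero [simp]: "line_restr x 0 = 0"
  by (simp add: line_restr_def)

lemma line_restr_add: "line_restr x (f + g) = line_restr x f + line_restr x g"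
proof -
  let ?M = "Poly_Mapping.keys f \<union> Poly_Mapping.keys g"
  have "Poly_Mapping.keys (f + g) \<subseteq> ?M" by (rule keys_add)
  then show ?thesis
    by (simp add: line_restr_superset[of ?M] lookup_add distrib_right sum.distrib[symmetric] add_monom)
qed

lemma line_restr_sum: "line_restr x (\<Sum>i\<in>I. f i) = (\<Sum>i\<in>I. line_restr x (f i))"
  by (induction I rule: infinite_finite_induct) (simp_all add: line_restr_add)

lemma line_restr_single:
  "line_restr x (Poly_Mapping.single m c) = monom (c * mon_val x m) (mon_deg m)"
  by (cases "c = 0") (simp_all add: line_restr_def)

lemma poly_mapping_expansion:
  "f = (\<Sum>m\<in>Poly_Mapping.keys f. Poly_Mapping.single m (Poly_Mapping.lookup f m))"
proof (rule poly_mapping_eqI)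
  fix k
  show "Poly_Mapping.lookup f k =
    Poly_Mapping.lookup (\<Sum>m\<in>Poly_Mapping.keys f. Poly_Mapping.single m (Poly_Mapping.lookup f m)) k"
    by (auto simp: lookup_sum lookup_single when_def in_keys_iff)
qed

text \<open>Both factors are expanded into terms; there \<open>mon_val\<close> is multiplicative and
  \<open>mon_deg\<close> additive, as the product of two \<open>monom\<close>s requires.\<close>

lemma line_restr_mult: "line_restr x (f * g) = line_restr x f * line_restr x g"
proof -
  have "f * g = (\<Sum>m\<in>Poly_Mapping.keys f. \<Sum>n\<in>Poly_Mapping.keys g.
      Poly_Mapping.single (m + n) (Poly_Mapping.lookup f m * Poly_Mapping.lookup g n))"
    using arg_cong2[OF poly_mapping_expansion[of f] poly_mapping_expansion[of g], of "(*)"]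
    by (simp only: sum_product mult_single)
  then have "line_restr x (f * g) = (\<Sum>m\<in>Poly_Mapping.keys f. \<Sum>n\<in>Poly_Mapping.keys g.
      monom (Poly_Mapping.lookup f m * mon_val x m) (mon_deg m) *
      monom (Poly_Mapping.lookup g n * mon_val x n) (mon_deg n))"
    by (simp add: line_restr_sum line_restr_single mon_val_add mon_deg_add mult_monom ac_simps)
  then show ?thesis
    by (simp add: line_restr_def sum_product)
qed

lemma line_restr_one [simp]: "line_restr x 1 = 1"
  using line_restr_single[of x 0 1] by simp

lemma line_restr_prod: "line_restr x (\<Prod>i\<in>I. f i) = (\<Prod>i\<in>I. line_restr x (f i))"
  by (induction I rule: infinite_finite_induct) (simp_all add: line_restr_mult)

text \<open>Carries the homomorphism laws of \<open>line_restr\<close> over to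
  \<open>peval\<close>.\<close>

lemma peval_conv_line_restr: "peval f x = poly (line_restr x f) 1"
  by (simp add: peval_eq line_restr_def poly_sum poly_monom)

lemma peval_add: "peval (f + g) x = peval f x + peval g x"
  by (simp add: peval_conv_line_restr line_restr_add)

lemma peval_mult: "peval (f * g) x = peval f x * peval g x"
  by (simp add: peval_conv_line_restr line_restr_mult)

lemma peval_single: "peval (Poly_Mapping.single m c) x = c * mon_val x m"
  by (simp add: peval_conv_line_restr line_restr_single poly_monom)

lemma peval_sum: "peval (\<Sum>i\<in>I. f i) x = (\<Sum>i\<in>I. peval (f i) x)"
  by (simp add: peval_conv_line_restr line_restr_sum poly_sum)

lemma peval_prod: "peval (\<Prod>i\<in>I. f i) x = (\<Prod>i\<in>I. peval (f i) x)"
  by (simp add: peval_conv_line_restr line_restr_prod poly_prod)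

lemma peval_const_mult: "peval (const_poly c * f) x = c * peval f x"
  by (simp add: peval_mult const_poly_def peval_single)

text \<open>All terms of a form land in the same power of t, so a form is in the kernel exactly when
  it vanishes at \<open>x\<close>.\<close>

lemma line_restr_homog: "f \<in> homog s d \<Longrightarrow> line_restr x f = monom (peval f x) d"
  by (simp add: line_restr_def peval_eq homog_def monom_sum)

lemma peval_scale_homog: "f \<in> homog s d \<Longrightarrow> peval f (\<lambda>i. c * x i) = c ^ d * peval f x"
  by (simp add: peval_eq homog_def mon_val_scale sum_distrib_left mult.left_commute)

section \<open>Closure properties of the ring S and its graded pieces\<close>

lemma zero_in_polyS [simp]: "0 \<in> polyS s"
  by (simp add: polyS_def)

lemma one_in_polyS [simp]: "1 \<in> polyS s"
  by (simp add: polyS_def)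

lemma single_in_polyS: "Poly_Mapping.keys m \<subseteq> {1..s} \<Longrightarrow> Poly_Mapping.single m c \<in> polyS s"
  by (simp add: polyS_def)

lemma add_in_polyS: "f \<in> polyS s \<Longrightarrow> g \<in> polyS s \<Longrightarrow> f + g \<in> polyS s"
  using keys_add[of f g] by (fastforce simp: polyS_def)

lemma mult_in_polyS: "f \<in> polyS s \<Longrightarrow> g \<in> polyS s \<Longrightarrow> f * g \<in> polyS s"
  unfolding polyS_def
proof safe
  fix m i assume fg: "\<forall>m\<in>Poly_Mapping.keys f. Poly_Mapping.keys m \<subseteq> {1..s}"
    "\<forall>m\<in>Poly_Mapping.keys g. Poly_Mapping.keys m \<subseteq> {1..s}"
    and "m \<in> Poly_Mapping.keys (f * g)" and i: "i \<in> Poly_Mapping.keys m"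
  then obtain a b where "a \<in> Poly_Mapping.keys f" "b \<in> Poly_Mapping.keys g" "m = a + b"
    using keys_mult[of f g] by blast
  with fg i keys_add[of a b] show "i \<in> {1..s}" by blast
qed

lemma sum_in_polyS: "(\<And>i. i \<in> I \<Longrightarrow> f i \<in> polyS s) \<Longrightarrow> (\<Sum>i\<in>I. f i) \<in> polyS s"
  by (induction I rule: infinite_finite_induct) (auto simp: add_in_polyS)

lemma prod_in_polyS: "(\<And>i. i \<in> I \<Longrightarrow> f i \<in> polyS s) \<Longrightarrow> (\<Prod>i\<in>I. f i) \<in> polyS s"
  by (induction I rule: infinite_finite_induct) (auto simp: mult_in_polyS)

lemma uminus_in_polyS: "f \<in> polyS s \<Longrightarrow> - f \<in> polyS s"
  by (simp add: polyS_def)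

lemma homog_imp_polyS: "f \<in> homog s d \<Longrightarrow> f \<in> polyS s"
  by (simp add: homog_def)

lemma zero_in_homog [simp]: "0 \<in> homog s d"
  by (simp add: homog_def)

lemma one_in_homog [simp]: "1 \<in> homog s 0"
  by (simp add: homog_def)

lemma single_in_homog:
  "Poly_Mapping.keys m \<subseteq> {1..s} \<Longrightarrow> mon_deg m = d \<Longrightarrow> Poly_Mapping.single m c \<in> homog s d"
  by (simp add: homog_def single_in_polyS)

lemma add_in_homog: "f \<in> homog s d \<Longrightarrow> g \<in> homog s d \<Longrightarrow> f + g \<in> homog s d"
  using keys_add[of f g] by (auto simp: homog_def add_in_polyS)

lemma sum_in_homog: "(\<And>i. i \<in> I \<Longrightarrow> f i \<in> homog s d) \<Longrightarrow> (\<Sum>i\<in>I. f i) \<in> homog s d"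
  by (induction I rule: infinite_finite_induct) (auto simp: add_in_homog)

lemma mult_in_homog:
  assumes "f \<in> homog s d" "g \<in> homog s e"
  shows "f * g \<in> homog s (d + e)"
proof -
  have "mon_deg m = d + e" if "m \<in> Poly_Mapping.keys (f * g)" for m
  proof -
    from that obtain a b where "a \<in> Poly_Mapping.keys f" "b \<in> Poly_Mapping.keys g" "m = a + b"
      using keys_mult[of f g] by blast
    with assms show ?thesis by (auto simp: homog_def mon_deg_add)
  qed
  with assms show ?thesis by (simp add: homog_def mult_in_polyS)
qed

lemma prod_in_homog:
  "finite I \<Longrightarrow> (\<And>i. i \<in> I \<Longrightarrow> f i \<in> homog s 1) \<Longrightarrow> (\<Prod>i\<in>I. f i) \<in> homog s (card I)"
proof (induction I rule: finite_induct)
  case (insert i I)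
  then show ?case using mult_in_homog[of "f i" s 1 "\<Prod>i\<in>I. f i" "card I"] by simp
qed simp

lemma const_mult_in_homog: "f \<in> homog s d \<Longrightarrow> const_poly c * f \<in> homog s d"
  using mult_in_homog[of "const_poly c" s 0 f d] by (simp add: const_poly_def single_in_homog)

subsection \<open>Leading monomials\<close>

text \<open>The condition under the definite description in \<open>lead_mon\<close>, kept as a
  predicate so that existence and uniqueness can be treated separately.\<close>

definition lex_max :: "'a::field mpoly \<Rightarrow> (nat \<Rightarrow>\<^sub>0 nat) \<Rightarrow> bool" where
  "lex_max f m \<longleftrightarrow> m \<in> Poly_Mapping.keys f \<and>
     (\<forall>m'\<in>Poly_Mapping.keys f. m' \<noteq> m \<longrightarrow> lex_less m' m)"

lemma lex_less_irrefl: "\<not> lex_less m m"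
  by (simp add: lex_less_def)

lemma lex_less_trans:
  assumes "lex_less a b" "lex_less b c"
  shows "lex_less a c"
proof -
  obtain i where i: "Poly_Mapping.lookup a i < Poly_Mapping.lookup b i"
    "\<forall>j>i. Poly_Mapping.lookup a j = Poly_Mapping.lookup b j"
    using assms(1) by (auto simp: lex_less_def)
  obtain k where k: "Poly_Mapping.lookup b k < Poly_Mapping.lookup c k"
    "\<forall>j>k. Poly_Mapping.lookup b j = Poly_Mapping.lookup c j"
    using assms(2) by (auto simp: lex_less_def)
  have "Poly_Mapping.lookup a (max i k) < Poly_Mapping.lookup c (max i k)"
  proof (cases i k rule: linorder_cases)
    case less
    then show ?thesis using i(2) k(1) by (simp add: max_def)
  next
    case equal
    then show ?thesis using i(1) k(1) by simp
  next
    case greater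
    then show ?thesis using i(1) k(2) by (simp add: max_def)
  qed
  moreover have "\<forall>j>max i k. Poly_Mapping.lookup a j = Poly_Mapping.lookup c j"
    using i k by simp
  ultimately show ?thesis unfolding lex_less_def by blast
qed

text \<open>Exponent vectors have finite support, so there is a largest index at which they differ,
  and it decides the comparison.\<close>

lemma lex_less_total:
  assumes "a \<noteq> b"
  shows "lex_less a b \<or> lex_less b a"
proof -
  let ?D = "{i. Poly_Mapping.lookup a i \<noteq> Poly_Mapping.lookup b i}"
  have "?D \<subseteq> Poly_Mapping.keys a \<union> Poly_Mapping.keys b"
  proof
    fix i assume "i \<in> ?D"
    then have "Poly_Mapping.lookup a i \<noteq> 0 \<or> Poly_Mapping.lookup b i \<noteq> 0" by simp linarith
    then show "i \<in> Poly_Mapping.keys a \<union> Poly_Mapping.keys b"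
      by (simp only: Un_iff in_keys_iff)
  qed
  then have fin: "finite ?D" by (rule finite_subset) simp
  have "?D \<noteq> {}" using assms poly_mapping_eqI[of a b] by (metis (mono_tags, lifting) empty_iff mem_Collect_eq)
  then have "Max ?D \<in> ?D" using fin by (rule Max_in[rotated])
  moreover have "\<forall>j>Max ?D. Poly_Mapping.lookup a j = Poly_Mapping.lookup b j"
  proof (intro allI impI, rule ccontr)
    fix j assume "j > Max ?D" "Poly_Mapping.lookup a j \<noteq> Poly_Mapping.lookup b j"
    then have "j \<le> Max ?D" using fin by (intro Max_ge) simp_all
    with \<open>j > Max ?D\<close> show False by linarith
  qed
  ultimately obtain i where "Poly_Mapping.lookup a i \<noteq> Poly_Mapping.lookup b i"
      and eq: "\<forall>j>i. Poly_Mapping.lookup a j = Poly_Mapping.lookup b j"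
    by blast
  then consider "Poly_Mapping.lookup a i < Poly_Mapping.lookup b i"
    | "Poly_Mapping.lookup b i < Poly_Mapping.lookup a i"
    by linarith
  then show ?thesis
  proof cases
    case 1
    with eq have "lex_less a b" unfolding lex_less_def by blast
    then show ?thesis ..
  next
    case 2
    with eq have "lex_less b a" unfolding lex_less_def by (intro exI[of _ i]) simp
    then show ?thesis ..
  qed
qed

lemma lead_mon_eqI: "lex_max f m \<Longrightarrow> lead_mon f = m"
  unfolding lead_mon_def
proof (rule the_equality)
  fix m' assume m: "lex_max f m"
    and m': "m' \<in> Poly_Mapping.keys f \<and>
      (\<forall>m\<in>Poly_Mapping.keys f. m \<noteq> m' \<longrightarrow> lex_less m m')"
  show "m' = m"
  proof (rule ccontr)
    assume "m' \<noteq> m"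
    with m m' have "lex_less m m'" "lex_less m' m" by (auto simp: lex_max_def)
    then show False using lex_less_trans lex_less_irrefl by blast
  qed
qed (simp add: lex_max_def)

text \<open>A finite nonempty set has a largest element for a total transitive relation; this makes
  \<open>lead_mon\<close> meaningful for nonzero polynomials.\<close>

lemma lex_max_lead_mon:
  assumes "f \<noteq> 0"
  shows "lex_max f (lead_mon f)"
proof -
  have "\<exists>m\<in>M. \<forall>m'\<in>M. m' \<noteq> m \<longrightarrow> lex_less m' m" if "finite M" "M \<noteq> {}" for M
    using that
  proof (induction M rule: finite_ne_induct)
    case (insert a M)
    then obtain m where m: "m \<in> M" "\<forall>m'\<in>M. m' \<noteq> m \<longrightarrow> lex_less m' m" by blast
    then show ?case
    proof (cases "lex_less m a")
      case True
      then have "\<forall>m'\<in>insert a M. m' \<noteq> a \<longrightarrow> lex_less m' a"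
        using m lex_less_trans[OF _ True] by auto
      then show ?thesis by blast
    next
      case False
      then have "a \<noteq> m \<longrightarrow> lex_less a m" using lex_less_total[of a m] by blast
      then show ?thesis using m by blast
    qed
  qed simp
  from this[of "Poly_Mapping.keys f"] obtain m where "lex_max f m"
    using assms unfolding lex_max_def by auto
  then show ?thesis using lead_mon_eqI by blast
qed

subsection \<open>The degree of the vanishing ideal\<close>

definition hom_comp :: "nat \<Rightarrow> 'a::field mpoly \<Rightarrow> 'a mpoly" where
  "hom_comp d f = (\<Sum>m\<in>{m\<in>Poly_Mapping.keys f. mon_deg m = d}.
     Poly_Mapping.single m (Poly_Mapping.lookup f m))"

lemma hom_comp_homog: "f \<in> polyS s \<Longrightarrow> hom_comp d f \<in> homog s d"
  unfolding hom_comp_def by (intro sum_in_homog single_in_homog) (auto simp: polyS_def)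

text \<open>Hence \<open>line_restr x f\<close> is zero exactly when every homogeneous component of
  \<open>f\<close> vanishes at \<open>x\<close>.\<close>

lemma peval_hom_comp: "peval (hom_comp d f) x = coeff (line_restr x f) d"
  unfolding hom_comp_def line_restr_def peval_sum peval_single coeff_sum coeff_monom
  by (subst sum.inter_filter[symmetric]) (auto intro: sum.cong)

lemma sum_hom_comp: "f = (\<Sum>d\<in>mon_deg ` Poly_Mapping.keys f. hom_comp d f)"
  unfolding hom_comp_def
  by (subst sum.image_gen[symmetric]) (simp_all add: poly_mapping_expansion[symmetric])

lemma ideal_gen_sum: "(\<And>i. i \<in> I \<Longrightarrow> f i \<in> ideal_gen s G) \<Longrightarrow> (\<Sum>i\<in>I. f i) \<in> ideal_gen s G"
  by (induction I rule: infinite_finite_induct) (auto intro: ideal_gen.zero ideal_gen.add)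

context
  fixes s :: nat and X :: "(nat \<Rightarrow> 'a::field) set set" and R :: "(nat \<Rightarrow> 'a) set"
  assumes X: "X = proj_pt ` R"
begin

text \<open>Rescaling a representative multiplies the value of a form by a power of the
  scalar.\<close>

lemma vanish_on_reps:
  assumes "f \<in> homog s d"
  shows "(\<forall>P\<in>X. \<forall>x\<in>P. peval f x = 0) \<longleftrightarrow> (\<forall>x\<in>R. peval f x = 0)"
proof
  assume "\<forall>P\<in>X. \<forall>x\<in>P. peval f x = 0"
  moreover have "x \<in> proj_pt x" for x :: "nat \<Rightarrow> 'a"
    by (auto simp: proj_pt_def intro: exI[of _ 1])
  ultimately show "\<forall>x\<in>R. peval f x = 0" unfolding X by blast
next
  assume "\<forall>x\<in>R. peval f x = 0"
  then show "\<forall>P\<in>X. \<forall>x\<in>P. peval f x = 0"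
    using assms by (auto simp: X proj_pt_def peval_scale_homog)
qed

text \<open>The generators lie in all the kernels, which are ideals. Conversely, the homogeneous
  components of a polynomial in all kernels vanish on \<open>R\<close>, so they are generators, and
  the polynomial is their sum.\<close>

lemma vanishing_ideal_eq:
  "vanishing_ideal s X = {f \<in> polyS s. \<forall>x\<in>R. line_restr x f = 0}"
proof (intro equalityI subsetI CollectI conjI)
  fix f assume f: "f \<in> vanishing_ideal s X"
  show "f \<in> polyS s"
    using f unfolding vanishing_ideal_def
    by induction (auto intro: add_in_polyS mult_in_polyS homog_imp_polyS)
  show "\<forall>x\<in>R. line_restr x f = 0"
    using f unfolding vanishing_ideal_def
  proof induction
    case (gen g)
    then obtain d where "g \<in> homog s d" "\<forall>P\<in>X. \<forall>x\<in>P. peval g x = 0" by blast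
    then show ?case using vanish_on_reps[of g d] by (simp add: line_restr_homog)
  qed (simp_all add: line_restr_add line_restr_mult)
next
  fix f assume f: "f \<in> {f \<in> polyS s. \<forall>x\<in>R. line_restr x f = 0}"
  have "hom_comp d f \<in> vanishing_ideal s X" for d
  proof -
    have h: "hom_comp d f \<in> homog s d" using f by (simp add: hom_comp_homog)
    moreover have "\<forall>x\<in>R. peval (hom_comp d f) x = 0" using f by (simp add: peval_hom_comp)
    ultimately have "\<forall>P\<in>X. \<forall>x\<in>P. peval (hom_comp d f) x = 0" using vanish_on_reps[OF h] by blast
    with h show ?thesis unfolding vanishing_ideal_def by (intro ideal_gen.gen) blast
  qed
  then show "f \<in> vanishing_ideal s X"
    by (subst sum_hom_comp) (auto simp: vanishing_ideal_def intro: ideal_gen_sum)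
qed

end

section \<open>Prime ideals above the vanishing ideal and the Krull dimension\<close>

lemma prime_ideal_prod:
  assumes "is_prime_ideal s P" "finite I" "\<And>i. i \<in> I \<Longrightarrow> f i \<in> polyS s" "(\<Prod>i\<in>I. f i) \<in> P"
  shows "\<exists>i\<in>I. f i \<in> P"
  using assms(2-4)
proof (induction I rule: finite_induct)
  \<comment> \<open>The empty product is 1, which no proper ideal contains.\<close>
  case empty
  have "P = polyS s"
  proof
    show "P \<subseteq> polyS s" using assms(1) by (simp add: is_prime_ideal_def is_ideal_def)
    show "polyS s \<subseteq> P"
    proof
      fix h :: "'a mpoly" assume "h \<in> polyS s"
      then have "h * 1 \<in> P"
        using assms(1) empty unfolding is_prime_ideal_def is_ideal_def prod.empty by blast
      then show "h \<in> P" by simp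
    qed
  qed
  then show ?case using assms(1) by (simp add: is_prime_ideal_def)
next
  case (insert i I)
  then have "f i * (\<Prod>i\<in>I. f i) \<in> P" by simp
  moreover have "f i \<in> polyS s" "(\<Prod>i\<in>I. f i) \<in> polyS s"
    using insert by (auto intro: prod_in_polyS)
  ultimately have "f i \<in> P \<or> (\<Prod>i\<in>I. f i) \<in> P"
    using assms(1) by (simp add: is_prime_ideal_def)
  then show ?case using insert by auto
qed

text \<open>The \<open>t\<^sub>i\<close>-section of \<open>line_restr x\<close> when \<open>x\<^sub>i \<noteq> 0\<close>.\<close>

definition line_lift :: "nat \<Rightarrow> 'a \<Rightarrow> 'a poly \<Rightarrow> 'a::field mpoly" where
  "line_lift i c p = (\<Sum>n\<le>degree p. Poly_Mapping.single (Poly_Mapping.single i n) (coeff p n / c ^ n))"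

lemma line_lift_in_polyS: "i \<in> {1..s} \<Longrightarrow> line_lift i c p \<in> polyS s"
  unfolding line_lift_def by (intro sum_in_polyS single_in_polyS) simp

lemma line_restr_line_lift: "x i \<noteq> 0 \<Longrightarrow> line_restr x (line_lift i (x i) p) = p"
  unfolding line_lift_def line_restr_sum line_restr_single by (simp add: poly_as_sum_of_monoms)

text \<open>Modulo the ideal of a point, \<open>S\<close> is the principal ideal domain \<open>K[t]\<close>, so a nonzero prime is
  maximal.\<close>

lemma no_prime_chain_above_point:
  assumes P0: "is_prime_ideal s P0" and P1: "is_prime_ideal s P1" and P2: "is_prime_ideal s P2"
    and chain: "P0 \<subset> P1" "P1 \<subset> P2"
    and i: "i \<in> {1..s}" "x i \<noteq> 0"
    and ker: "{f \<in> polyS s. line_restr x f = 0} \<subseteq> P0"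
  shows False
proof -
  define L where "L = line_lift i (x i)"
  have LS: "L p \<in> polyS s" and RL: "line_restr x (L p) = p" for p
    using i by (simp_all add: L_def line_lift_in_polyS line_restr_line_lift)
  have neg: "- f \<in> P" if "is_ideal s P" "f \<in> P" for f P
  proof -
    have "- 1 \<in> polyS s" by (rule uminus_in_polyS) simp
    then have "- 1 * f \<in> P" using that unfolding is_ideal_def by blast
    then show ?thesis by simp
  qed
  \<comment> \<open>An ideal above \<open>P0\<close> contains the kernel of
    \<open>line_restr x\<close>, so membership depends only on the image in K[t].\<close>
  have transfer: "f \<in> P"
    if P: "is_ideal s P" "P0 \<subseteq> P" and g: "g \<in> P" and f: "f \<in> polyS s" and eq: "line_restr x f = line_restr x g"
    for f g P
  proof -
    have gS: "g \<in> polyS s" using P g by (auto simp: is_ideal_def)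
    have "line_restr x (f + (- g)) + line_restr x g = line_restr x f"
      by (simp add: line_restr_add[symmetric])
    then have "line_restr x (f + (- g)) = 0" using eq by simp
    moreover have "f + (- g) \<in> polyS s" using f gS by (intro add_in_polyS uminus_in_polyS)
    ultimately have "f + (- g) \<in> P" using ker P by blast
    then have "(f + (- g)) + g \<in> P" using P g unfolding is_ideal_def by blast
    then show ?thesis by simp
  qed
  have ideals: "is_ideal s P1" "is_ideal s P2"
    using P1 P2 by (simp_all add: is_prime_ideal_def)
  \<comment> \<open>Division with remainder: an element whose image has least degree generates the
    image of the ideal.\<close>
  have gen: "\<exists>g\<in>P. line_restr x g \<noteq> 0 \<and> (\<forall>f\<in>P. line_restr x g dvd line_restr x f)"
    if P: "is_ideal s P" "P0 \<subseteq> P" and nz: "\<exists>f\<in>P. line_restr x f \<noteq> 0" for P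
  proof -
    let ?Q = "\<lambda>g. g \<in> P \<and> line_restr x g \<noteq> 0"
    define g where "g = arg_min (\<lambda>g. degree (line_restr x g)) ?Q"
    from nz obtain f0 where "?Q f0" by blast
    then have g: "?Q g" and min: "\<And>h. ?Q h \<Longrightarrow> degree (line_restr x g) \<le> degree (line_restr x h)"
      unfolding g_def
      using arg_min_natI[of ?Q f0 "\<lambda>g. degree (line_restr x g)"]
        arg_min_nat_le[of ?Q _ "\<lambda>g. degree (line_restr x g)"] by blast+
    have "line_restr x g dvd line_restr x f" if f: "f \<in> P" for f
    proof -
      let ?q = "line_restr x f div line_restr x g" and ?r = "line_restr x f mod line_restr x g"
      let ?h = "f + L (- ?q) * g"
      have "L (- ?q) * g \<in> P" using P g LS unfolding is_ideal_def by blast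
      then have h: "?h \<in> P" using P f unfolding is_ideal_def by blast
      have "line_restr x ?h = ?r"
        by (simp add: line_restr_add line_restr_mult RL minus_div_mult_eq_mod)
      then have "?r = 0"
        using min[of ?h] h degree_mod_less[of "line_restr x g" "line_restr x f"] g by fastforce
      then show ?thesis by (rule mod_0_imp_dvd)
    qed
    with g show ?thesis by blast
  qed
  \<comment> \<open>If all images were zero, \<open>P\<close> would lie in the kernel and hence in
    \<open>P0\<close>.\<close>
  have new: "\<exists>f\<in>P. line_restr x f \<noteq> 0" if "is_ideal s P" "P0 \<subset> P" for P
    using that ker by (fastforce simp: is_ideal_def)
  obtain g where g: "g \<in> P1" "line_restr x g \<noteq> 0" and g_dvd: "\<forall>f\<in>P1. line_restr x g dvd line_restr x f"
    using gen[OF ideals(1)] new[OF ideals(1)] chain by blast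
  obtain h where h: "h \<in> P2" and h_dvd: "\<forall>f\<in>P2. line_restr x h dvd line_restr x f"
    using gen[OF ideals(2)] new[OF ideals(2)] chain by blast
  from g(1) chain h_dvd obtain u where u: "line_restr x g = line_restr x h * u" by blast
  have hS: "h \<in> polyS s" using h ideals by (auto simp: is_ideal_def)
  \<comment> \<open>This product has the same image as \<open>g\<close>. Primality leaves two cases:
    \<open>h\<close> in \<open>P1\<close> collapses \<open>P2\<close> to \<open>P1\<close>, and
    \<open>L u\<close> in \<open>P1\<close> makes the image of \<open>h\<close> a unit.\<close>
  have "h * L u \<in> P1"
    by (rule transfer[OF ideals(1) _ g(1)])
      (use chain hS LS u in \<open>auto simp: mult_in_polyS line_restr_mult RL\<close>)
  then have "h \<in> P1 \<or> L u \<in> P1"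
    using P1 hS LS unfolding is_prime_ideal_def by blast
  then show False
  proof
    assume hP1: "h \<in> P1"
    have "f \<in> P1" if f: "f \<in> P2" for f
    proof -
      from f h_dvd obtain v where v: "line_restr x f = line_restr x h * v" by blast
      have "L v * h \<in> P1" using hP1 ideals(1) LS unfolding is_ideal_def by blast
      then show ?thesis
        by (rule transfer[OF ideals(1), rotated])
          (use chain f ideals v in \<open>auto simp: is_ideal_def line_restr_mult RL\<close>)
    qed
    with chain show False by blast
  next
    assume "L u \<in> P1"
    then have "line_restr x g dvd u" using g_dvd RL by metis
    then have "line_restr x h * u dvd 1 * u" using u by simp
    moreover have "u \<noteq> 0" using u g by auto
    ultimately have "line_restr x h dvd 1" using dvd_mult_cancel_right by blast
    then obtain w where w: "1 = line_restr x h * w" ..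
    have "L w * h \<in> P2" using h ideals(2) LS unfolding is_ideal_def by blast
    then have "1 \<in> P2"
      by (rule transfer[OF ideals(2), rotated])
        (use chain w in \<open>auto simp: line_restr_mult RL mult.commute\<close>)
    then have "(\<Prod>i\<in>({}::nat set). 1) \<in> P2" by simp
    from prime_ideal_prod[OF P2 _ _ this] show False by simp
  qed
qed

text \<open>\<open>Q\<close> stands for membership in a prime ideal of K[t]; the equivalence for
  products expresses absorption and primality at once.\<close>

lemma is_prime_ideal_line_restr_vimage:
  assumes i: "i \<in> {1..s}" "x i \<noteq> 0" and "Q 0" "\<not> Q 1"
    and "\<And>p q. Q p \<Longrightarrow> Q q \<Longrightarrow> Q (p + q)" "\<And>p q. Q (p * q) \<longleftrightarrow> Q p \<or> Q q"
  shows "is_prime_ideal s {f \<in> polyS s. Q (line_restr x f)}"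
proof -
  have "1 \<in> polyS s" "1 \<notin> {f \<in> polyS s. Q (line_restr x f)}" using assms by auto
  then have "{f \<in> polyS s. Q (line_restr x f)} \<noteq> polyS s" by blast
  with assms(3-) show ?thesis
    unfolding is_prime_ideal_def is_ideal_def
    by (auto simp: add_in_polyS mult_in_polyS line_restr_add line_restr_mult)
qed

text \<open>The ideal of a point and the irrelevant ideal form a chain of length 1. Conversely, the
  lowest prime of a chain contains the ideal of some point, so
  \<open>no_prime_chain_above_point\<close> applies.\<close>

lemma krull_dim_vanishing_ideal:
  fixes X :: "(nat \<Rightarrow> 'a::field) set set"
  assumes X: "X = proj_pt ` R" and R: "finite R" "R \<noteq> {}" "\<And>x. x \<in> R \<Longrightarrow> \<exists>i\<in>{1..s}. x i \<noteq> 0"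
  shows "krull_dim s (vanishing_ideal s X) = 1"
proof -
  let ?I = "vanishing_ideal s X"
  let ?C = "{n. \<exists>Ps :: 'a mpoly set list. length Ps = Suc n \<and>
      (\<forall>P\<in>set Ps. is_prime_ideal s P \<and> ?I \<subseteq> P) \<and> (\<forall>i<n. Ps ! i \<subset> Ps ! Suc i)}"
  note I = vanishing_ideal_eq[OF X, of s]
  have "1 \<in> ?C"
  proof -
    from R obtain x i where x: "x \<in> R" "i \<in> {1..s}" "x i \<noteq> 0" by blast
    \<comment> \<open>The value at t = 0 is the constant term of \<open>f\<close>, so
      \<open>?Q\<close> is the irrelevant ideal.\<close>
    let ?P = "{f \<in> polyS s. line_restr x f = 0}" and ?Q = "{f \<in> polyS s. poly (line_restr x f) 0 = 0}"
    have "is_prime_ideal s ?P"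
      using x by (intro is_prime_ideal_line_restr_vimage[of i]) auto
    moreover have "is_prime_ideal s ?Q"
      using x by (intro is_prime_ideal_line_restr_vimage[of i s x "\<lambda>p. poly p 0 = 0"]) auto
    moreover have "?P \<subset> ?Q"
    proof
      have "line_lift i (x i) [:0, 1:] \<in> ?Q - ?P"
        using x by (auto simp: line_lift_in_polyS line_restr_line_lift)
      then show "?P \<noteq> ?Q" by blast
    qed auto
    moreover have "?I \<subseteq> ?P" "?I \<subseteq> ?Q" unfolding I using x by auto
    ultimately show ?thesis by (intro CollectI exI[of _ "[?P, ?Q]"]) auto
  qed
  moreover have "n \<le> 1" if n: "n \<in> ?C" for n
  proof (rule ccontr)
    assume "\<not> n \<le> 1"
    from n obtain Ps :: "'a mpoly set list" where len: "length Ps = Suc n"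
      and Ps: "\<forall>P\<in>set Ps. is_prime_ideal s P \<and> ?I \<subseteq> P" "\<forall>i<n. Ps ! i \<subset> Ps ! Suc i"
      by blast
    have prime: "is_prime_ideal s (Ps ! j) \<and> ?I \<subseteq> Ps ! j" if "j \<le> n" for j
      using that Ps(1) len by simp
    have P0: "is_prime_ideal s (Ps ! 0)" "?I \<subseteq> Ps ! 0" using prime[of 0] by auto
    \<comment> \<open>Otherwise choose, for each point, a polynomial of its ideal outside
      \<open>Ps ! 0\<close>; their product lies in the vanishing ideal, hence in the prime
      \<open>Ps ! 0\<close>.\<close>
    have "\<exists>x\<in>R. {f \<in> polyS s. line_restr x f = 0} \<subseteq> Ps ! 0"
    proof (rule ccontr)
      assume "\<not> ?thesis"
      then have "\<forall>x\<in>R. \<exists>f. f \<in> polyS s \<and> line_restr x f = 0 \<and> f \<notin> Ps ! 0" by blast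
      then obtain F where F: "\<forall>x\<in>R. F x \<in> polyS s \<and> line_restr x (F x) = 0 \<and> F x \<notin> Ps ! 0"
        by metis
      have "(\<Prod>x\<in>R. F x) \<in> ?I"
        unfolding I using F R(1) by (auto simp: prod_in_polyS line_restr_prod)
      with P0 F R(1) prime_ideal_prod[of s "Ps ! 0" R F] show False by blast
    qed
    then obtain x i where "{f \<in> polyS s. line_restr x f = 0} \<subseteq> Ps ! 0" "i \<in> {1..s}" "x i \<noteq> 0"
      using R by blast
    moreover have "Ps ! 0 \<subset> Ps ! 1" "Ps ! 1 \<subset> Ps ! 2"
      using Ps(2)[rule_format, of 0] Ps(2)[rule_format, of 1] \<open>\<not> n \<le> 1\<close>
      by (simp_all add: numeral_2_eq_2)
    ultimately show False
      using prime[of 0] prime[of 1] prime[of 2] \<open>\<not> n \<le> 1\<close>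
        no_prime_chain_above_point[of s "Ps ! 0" "Ps ! 1" "Ps ! 2" i x] by auto
  qed
  ultimately show ?thesis
    unfolding krull_dim_def by (rule cSup_eq_maximum)
qed

section \<open>Hilbert function and degree of a finite set of points\<close>

lemma vanishing_ideal_peval:
  assumes "X = proj_pt ` R" "f \<in> vanishing_ideal s X" "x \<in> R"
  shows "peval f x = 0"
  using assms vanishing_ideal_eq[OF assms(1)] by (simp add: peval_conv_line_restr)

text \<open>Evaluation on \<open>R\<close> is injective on the span of \<open>B\<close>; as \<open>K\<close> is finite, counting coefficient
  functions replaces a dimension argument.\<close>

lemma lin_indep_card_le:
  fixes X :: "(nat \<Rightarrow> 'a::{finite,field}) set set"
  assumes X: "X = proj_pt ` R" and finR: "finite R"
    and B: "B \<subseteq> homog s d" "lin_indep_mod (vanishing_ideal s X \<inter> homog s d) B"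
  shows "card B \<le> card R"
proof -
  let ?lc = "\<lambda>c. \<Sum>b\<in>B. const_poly (c b) * b"
  let ?ev = "\<lambda>c. restrict (\<lambda>x. peval (?lc c) x) R"
  have finB: "finite B" using B by (simp add: lin_indep_mod_def)
  have "inj_on ?ev (B \<rightarrow>\<^sub>E UNIV)"
  proof (rule inj_onI)
    fix c c' assume c: "c \<in> B \<rightarrow>\<^sub>E (UNIV :: 'a set)" "c' \<in> B \<rightarrow>\<^sub>E (UNIV :: 'a set)" and eq: "?ev c = ?ev c'"
    let ?h = "?lc (\<lambda>b. c b - c' b)"
    have h: "?h \<in> homog s d"
      using B(1) by (auto intro!: sum_in_homog const_mult_in_homog)
    have "peval ?h x = 0" if "x \<in> R" for x
    proof -
      have "peval ?h x = peval (?lc c) x - peval (?lc c') x"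
        by (simp add: peval_sum peval_const_mult left_diff_distrib sum_subtractf)
      also have "\<dots> = 0" using fun_cong[OF eq, of x] that by simp
      finally show ?thesis .
    qed
    with h have "?h \<in> vanishing_ideal s X \<inter> homog s d"
      by (simp add: vanishing_ideal_eq[OF X] line_restr_homog homog_imp_polyS)
    with B(2) have "\<forall>b\<in>B. c b - c' b = 0"
      unfolding lin_indep_mod_def by (elim conjE allE[of _ "\<lambda>b. c b - c' b"]) simp
    then show "c = c'" using c by (intro PiE_ext) auto
  qed
  moreover have "?ev ` (B \<rightarrow>\<^sub>E UNIV) \<subseteq> R \<rightarrow>\<^sub>E UNIV" by auto
  moreover have "finite (R \<rightarrow>\<^sub>E (UNIV :: 'a set))" using finR by (intro finite_PiE) auto
  ultimately have "card (B \<rightarrow>\<^sub>E (UNIV :: 'a set)) \<le> card (R \<rightarrow>\<^sub>E (UNIV :: 'a set))"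
    using card_inj_on_le by blast
  then have "card (UNIV :: 'a set) ^ card B \<le> card (UNIV :: 'a set) ^ card R"
    using finB finR by (simp add: card_funcsetE)
  moreover have "1 < card (UNIV :: 'a set)"
    using card_mono[of "UNIV :: 'a set" "{0, 1}"] by simp
  ultimately show ?thesis by simp
qed

text \<open>Each \<open>y\<close> is a zero of a linear form t_i y_j - t_j y_i that is nonzero at
  \<open>x\<close>. These are multiplied and padded to degree \<open>d\<close> with a power of a
  variable not vanishing at \<open>x\<close>.\<close>

lemma separating_form:
  fixes x :: "nat \<Rightarrow> 'a::field"
  assumes "finite T" "card T \<le> d" "\<And>y. y \<in> T \<Longrightarrow> \<exists>i\<in>{1..s}. \<exists>j\<in>{1..s}. x i * y j \<noteq> x j * y i"
    and x: "i \<in> {1..s}" "x i \<noteq> 0"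
  shows "\<exists>f\<in>homog s d. peval f x \<noteq> 0 \<and> (\<forall>y\<in>T. peval f y = 0)"
proof -
  have t: "Poly_Mapping.single (Poly_Mapping.single i n) c \<in> homog s n" if "i \<in> {1..s}" for i n and c :: 'a
    using that by (intro single_in_homog) auto
  have "\<exists>g. g \<in> homog s 1 \<and> peval g x \<noteq> 0 \<and> peval g y = 0" if y: "y \<in> T" for y
  proof -
    from assms(3)[OF y] obtain i j where ij: "i \<in> {1..s}" "j \<in> {1..s}" "x i * y j \<noteq> x j * y i" by blast
    let ?g = "Poly_Mapping.single (Poly_Mapping.single i 1) (y j) +
      Poly_Mapping.single (Poly_Mapping.single j 1) (- y i)"
    have "?g \<in> homog s 1" using ij by (intro add_in_homog t)
    moreover have "peval ?g x \<noteq> 0" "peval ?g y = 0"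
      using ij(3) by (simp_all add: peval_add peval_single mult.commute)
    ultimately show ?thesis by blast
  qed
  then obtain g where g: "\<forall>y\<in>T. g y \<in> homog s 1 \<and> peval (g y) x \<noteq> 0 \<and> peval (g y) y = 0" by metis
  let ?f = "(\<Prod>y\<in>T. g y) * Poly_Mapping.single (Poly_Mapping.single i (d - card T)) 1"
  have "?f \<in> homog s (card T + (d - card T))"
    using g x assms(1) by (intro mult_in_homog prod_in_homog t) auto
  then have "?f \<in> homog s d" using assms(2) by simp
  moreover have "peval ?f x \<noteq> 0" "\<forall>y\<in>T. peval ?f y = 0"
    using g x assms(1) by (auto simp: peval_mult peval_prod peval_single)
  ultimately show ?thesis by blast
qed

text \<open>Vanishing 2x2 minors make the vectors proportional; so distinct points have a nonzero
  minor, as \<open>separating_form\<close> demands.\<close>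

lemma proj_pt_eqI:
  assumes "i \<in> {1..s}" "x i \<noteq> 0" "\<exists>j. y j \<noteq> 0" "\<And>j. j \<notin> {1..s} \<Longrightarrow> x j = 0" "\<And>j. j \<notin> {1..s} \<Longrightarrow> y j = 0"
    and eq: "\<And>i j. i \<in> {1..s} \<Longrightarrow> j \<in> {1..s} \<Longrightarrow> x i * y j = x j * y i"
  shows "proj_pt x = proj_pt (y :: nat \<Rightarrow> 'a::field)"
proof -
  define c where "c = y i / x i"
  have y: "y = (\<lambda>j. c * x j)"
  proof
    fix j
    show "y j = c * x j"
    proof (cases "j \<in> {1..s}")
      case True
      with eq[of i j] assms(1,2) show ?thesis by (simp add: c_def field_simps)
    qed (use assms(4,5) in simp)
  qed
  then have "c \<noteq> 0" using assms(3) by auto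
  have "\<exists>b'. (\<lambda>j. b * x j) = (\<lambda>j. b' * y j) \<and> b' \<noteq> 0" if "b \<noteq> 0" for b
    using that \<open>c \<noteq> 0\<close> unfolding y by (intro exI[of _ "b / c"]) simp
  moreover have "\<exists>b'. (\<lambda>j. b * y j) = (\<lambda>j. b' * x j) \<and> b' \<noteq> 0" if "b \<noteq> 0" for b
    using that \<open>c \<noteq> 0\<close> unfolding y by (intro exI[of _ "b * c"]) (simp add: mult.assoc)
  ultimately show ?thesis
    unfolding proj_pt_def by blast
qed

text \<open>Separating forms of degree \<open>d\<close> are dual to the points, hence independent;
  the opposite bound is \<open>lin_indep_card_le\<close>.\<close>

lemma hilbert_fun_vanishing_ideal:
  fixes X :: "(nat \<Rightarrow> 'a::{finite,field}) set set"
  assumes X: "X = proj_pt ` R" and inj: "inj_on proj_pt R" and R: "finite R"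
    "\<And>x. x \<in> R \<Longrightarrow> x \<noteq> (\<lambda>_. 0)" "\<And>x i. x \<in> R \<Longrightarrow> i \<notin> {1..s} \<Longrightarrow> x i = 0"
    and d: "card R \<le> d"
  shows "hilbert_fun s (vanishing_ideal s X) d = card R"
proof -
  let ?I = "vanishing_ideal s X \<inter> homog s d"
  have nz: "\<exists>i\<in>{1..s}. x i \<noteq> 0" if "x \<in> R" for x
    using R(2,3)[OF that] by blast
  have "\<exists>f\<in>homog s d. peval f x \<noteq> 0 \<and> (\<forall>y\<in>R - {x}. peval f y = 0)" if x: "x \<in> R" for x
  proof -
    from nz[OF x] obtain i where i: "i \<in> {1..s}" "x i \<noteq> 0" by blast
    show ?thesis
    proof (rule separating_form[where i = i])
      fix y assume y: "y \<in> R - {x}"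
      then have "proj_pt x \<noteq> proj_pt y" using inj x by (auto simp: inj_on_def)
      then show "\<exists>i\<in>{1..s}. \<exists>j\<in>{1..s}. x i * y j \<noteq> x j * y i"
        using proj_pt_eqI[of i s x y] i nz[of y] R(3) x y by (metis DiffD1)
    next
      show "card (R - {x}) \<le> d" using d card_Diff1_le[of R x] by linarith
    qed (use R i in simp_all)
  qed
  then obtain F where F: "\<And>x. x \<in> R \<Longrightarrow> F x \<in> homog s d"
    "\<And>x. x \<in> R \<Longrightarrow> peval (F x) x \<noteq> 0" "\<And>x y. x \<in> R \<Longrightarrow> y \<in> R \<Longrightarrow> y \<noteq> x \<Longrightarrow> peval (F x) y = 0"
    by (metis DiffI singletonD)
  have injF: "inj_on F R" using F by (metis inj_onI)
  have "lin_indep_mod ?I (F ` R)"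
    unfolding lin_indep_mod_def
  proof (intro conjI allI impI ballI)
    show "finite (F ` R)" using R by simp
    fix c b assume mem: "(\<Sum>b\<in>F ` R. const_poly (c b) * b) \<in> ?I" and "b \<in> F ` R"
    then obtain x where x: "x \<in> R" "b = F x" by blast
    have "0 = peval (\<Sum>b\<in>F ` R. const_poly (c b) * b) x"
      by (rule vanishing_ideal_peval[OF X _ x(1), symmetric]) (use mem in blast)
    also have "\<dots> = (\<Sum>y\<in>R. c (F y) * peval (F y) x)"
      using injF by (simp add: peval_sum peval_const_mult sum.reindex)
    also have "\<dots> = (\<Sum>y\<in>{x}. c (F y) * peval (F y) x)"
      using R x F by (intro sum.mono_neutral_right) auto
    finally show "c b = 0" using F x by simp
  qed
  then have "card R \<in> {card B | B. B \<subseteq> homog s d \<and> lin_indep_mod ?I B}"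
    using F(1) injF by (intro CollectI exI[of _ "F ` R"]) (auto simp: card_image)
  moreover have "n \<le> card R" if "n \<in> {card B | B. B \<subseteq> homog s d \<and> lin_indep_mod ?I B}" for n
    using that lin_indep_card_le[OF X R(1)] by auto
  ultimately show ?thesis
    unfolding hilbert_fun_def by (rule cSup_eq_maximum)
qed

text \<open>In Krull dimension 1 the degree is the limit of the Hilbert function itself, which is
  eventually constant.\<close>

lemma deg_quot_vanishing_ideal:
  fixes X :: "(nat \<Rightarrow> 'a::{finite,field}) set set"
  assumes X: "X = proj_pt ` R" and R: "finite R" "R \<noteq> {}"
    "\<And>x. x \<in> R \<Longrightarrow> x \<noteq> (\<lambda>_. 0)" "\<And>x i. x \<in> R \<Longrightarrow> i \<notin> {1..s} \<Longrightarrow> x i = 0"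
  shows "deg_quot s (vanishing_ideal s X) = real (card X)"
proof -
  \<comment> \<open>\<open>R\<close> may contain several representatives of a point;
    \<open>T\<close> keeps exactly one of each.\<close>
  obtain T where T: "T \<subseteq> R" "inj_on proj_pt T" "X = proj_pt ` T"
    using X by (metis subset_image_inj subset_refl)
  have card: "card X = card T" using T by (simp add: card_image)
  have "\<exists>i\<in>{1..s}. x i \<noteq> 0" if "x \<in> R" for x
    using R(3,4)[OF that] by blast
  then have "krull_dim s (vanishing_ideal s X) = 1"
    using X R by (intro krull_dim_vanishing_ideal) auto
  moreover have "hilbert_fun s (vanishing_ideal s X) d = card T" if "card T \<le> d" for d
    using T R that by (intro hilbert_fun_vanishing_ideal) (auto intro: finite_subset)
  then have "(\<lambda>d. real (hilbert_fun s (vanishing_ideal s X) d)) \<longlonglongrightarrow> real (card T)"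
    by (intro tendsto_eventually eventually_sequentiallyI[of "card T"]) simp
  then have "lim (\<lambda>d. real (hilbert_fun s (vanishing_ideal s X) d)) = real (card T)"
    by (rule limI)
  ultimately show ?thesis
    by (simp add: deg_quot_def card)
qed

subsection \<open>Nonzeros on a grid\<close>

lemma card_nonroots_ge:
  fixes p :: "'a::field poly"
  assumes "finite A" "p \<noteq> 0" "degree p \<le> e"
  shows "card A - e \<le> card {t \<in> A. poly p t \<noteq> 0}"
proof -
  have "card {t. poly p t = 0} \<le> e"
    using card_poly_roots_bound[OF assms(2)] assms(3) by linarith
  moreover have "card (A - {t. poly p t = 0}) \<ge> card A - card {t. poly p t = 0}"
    using poly_roots_finite[OF assms(2)] by (intro diff_card_le_card_Diff)
  moreover have "A - {t. poly p t = 0} = {t \<in> A. poly p t \<noteq> 0}" by auto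
  ultimately show ?thesis by simp
qed

text \<open>Split off the lexicographically largest variable: over each nonzero of the leading coefficient
  there is a nonzero univariate polynomial whose degree is the last exponent of the leading
  monomial.\<close>

lemma lex_footprint_bound:
  fixes c :: "'m \<Rightarrow> 'a::field" and ex :: "'m \<Rightarrow> nat \<Rightarrow> nat" and I :: "nat set"
  assumes "finite I" "\<And>i. i \<in> I \<Longrightarrow> finite (A i)"
    and "finite M" "a \<in> M" "c a \<noteq> 0"
    and "\<And>m. m \<in> M \<Longrightarrow> m \<noteq> a \<Longrightarrow>
      \<exists>i\<in>I. ex m i < ex a i \<and> (\<forall>j\<in>I. i < j \<longrightarrow> ex m j = ex a j)"
  shows "(\<Prod>i\<in>I. card (A i) - ex a i)
    \<le> card {x \<in> PiE I A. (\<Sum>m\<in>M. c m * (\<Prod>i\<in>I. x i ^ ex m i)) \<noteq> 0}"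
  using assms
proof (induction I arbitrary: M rule: finite_linorder_max_induct)
  case empty
  then have "M = {a}" by auto
  with empty have "{x \<in> PiE {} A. (\<Sum>m\<in>M. c m * (\<Prod>i\<in>{}. x i ^ ex m i)) \<noteq> 0} = {\<lambda>_. undefined}"
    by auto
  then show ?case by simp
next
  case (insert b I)
  \<comment> \<open>The exponents agreeing with \<open>a\<close> at \<open>b\<close>: they make up
    the coefficient of degree \<open>ex a b\<close> in \<open>p x\<close>.\<close>
  let ?M' = "{m \<in> M. ex m b = ex a b}"
  let ?g = "\<lambda>x m. c m * (\<Prod>i\<in>I. x i ^ ex m i)"
  let ?N = "{x \<in> PiE I A. (\<Sum>m\<in>?M'. ?g x m) \<noteq> 0}"
  let ?N' = "{x \<in> PiE (insert b I) A. (\<Sum>m\<in>M. c m * (\<Prod>i\<in>insert b I. x i ^ ex m i)) \<noteq> 0}"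
  define p where "p x = (\<Sum>m\<in>M. monom (?g x m) (ex m b))" for x
  have b: "b \<notin> I" using insert.hyps by auto
  have IH: "(\<Prod>i\<in>I. card (A i) - ex a i) \<le> card ?N"
  proof (rule insert.IH)
    fix m assume "m \<in> ?M'" "m \<noteq> a"
    with insert.prems(5)[of m] obtain i where
      "i \<in> insert b I" "ex m i < ex a i" "\<forall>j\<in>insert b I. i < j \<longrightarrow> ex m j = ex a j"
      by auto
    then show "\<exists>i\<in>I. ex m i < ex a i \<and> (\<forall>j\<in>I. i < j \<longrightarrow> ex m j = ex a j)"
      using \<open>m \<in> ?M'\<close> by (intro bexI[of _ i]) auto
  qed (use insert.prems in auto)
  \<comment> \<open>The index deciding between \<open>m\<close> and \<open>a\<close> is
    \<open>b\<close> itself or lies below it, with equality at \<open>b\<close>.\<close>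
  have le: "ex m b \<le> ex a b" if m: "m \<in> M" for m
  proof (cases "m = a")
    case False
    then obtain i where "i \<in> insert b I" "ex m i < ex a i"
      "\<forall>j\<in>insert b I. i < j \<longrightarrow> ex m j = ex a j"
      using insert.prems(5)[OF m] by blast
    with insert.hyps show ?thesis by (cases "i = b") auto
  qed simp
  have p_deg: "degree (p x) \<le> ex a b" for x
    unfolding p_def by (intro degree_sum_le[OF insert.prems(2)])
      (use le degree_monom_le order_trans in blast)
  have p_coeff: "coeff (p x) (ex a b) = (\<Sum>m\<in>?M'. ?g x m)" for x
    using insert.prems(2) unfolding p_def coeff_sum coeff_monom
    by (subst sum.inter_filter[symmetric]) (auto intro: sum.cong)
  have p_nz: "p x \<noteq> 0" if "x \<in> ?N" for x
    using that p_coeff[of x] by auto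
  have p_poly: "poly (p x) t = (\<Sum>m\<in>M. c m * (\<Prod>i\<in>insert b I. (x(b := t)) i ^ ex m i))" for x t
  proof -
    have "(\<Prod>i\<in>insert b I. (x(b := t)) i ^ ex m i) = t ^ ex m b * (\<Prod>i\<in>I. x i ^ ex m i)" for m
    proof -
      have "(\<Prod>i\<in>I. (x(b := t)) i ^ ex m i) = (\<Prod>i\<in>I. x i ^ ex m i)"
        using b by (intro prod.cong) auto
      then show ?thesis using b insert.hyps(1) by simp
    qed
    then show ?thesis
      by (simp only:) (simp add: p_def poly_sum poly_monom ac_simps)
  qed
  let ?S = "SIGMA x:?N. {t \<in> A b. poly (p x) t \<noteq> 0}"
  have "finite (PiE I A)" "finite (PiE (insert b I) A)"
    using insert.hyps(1) insert.prems(1) by (auto intro!: finite_PiE)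
  then have finN: "finite ?N" and finN': "finite ?N'"
    by simp_all
  have "(\<lambda>(x, t). x(b := t)) ` ?S \<subseteq> ?N'"
    using p_poly by (auto simp: PiE_def extensional_def)
  moreover have "inj_on (\<lambda>(x, t). x(b := t)) ?S"
  \<comment> \<open>Functions in \<open>PiE I A\<close> are all \<open>undefined\<close> at
    \<open>b\<close>, so the update there loses nothing.\<close>
  proof (rule inj_onI, clarify)
    fix x t y u
    assume "x \<in> PiE I A" "y \<in> PiE I A" and eq: "x(b := t) = y(b := u)"
    then have "x b = y b" using b by (simp add: PiE_def extensional_def)
    with eq show "x = y \<and> t = u"
      by (metis fun_upd_eqD fun_upd_triv fun_upd_upd)
  qed
  ultimately have "card ?S \<le> card ?N'"
    using finN' card_inj_on_le by blast
  moreover have "card ?S = (\<Sum>x\<in>?N. card {t \<in> A b. poly (p x) t \<noteq> 0})"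
    using finN insert.prems(1) by (intro card_SigmaI) auto
  moreover have "(\<Sum>x\<in>?N. card (A b) - ex a b) \<le> (\<Sum>x\<in>?N. card {t \<in> A b. poly (p x) t \<noteq> 0})"
    using insert.prems(1) p_deg p_nz by (intro sum_mono card_nonroots_ge) auto
  ultimately have "card ?N * (card (A b) - ex a b) \<le> card ?N'"
    by simp
  moreover have "(\<Prod>i\<in>insert b I. card (A i) - ex a i)
      = (\<Prod>i\<in>I. card (A i) - ex a i) * (card (A b) - ex a b)"
    using b insert.hyps(1) by simp
  moreover have "\<dots> \<le> card ?N * (card (A b) - ex a b)"
    using IH by (rule mult_right_mono) simp
  ultimately show ?case by linarith
qed

text \<open>Given the sum of the \<open>u\<^sub>j \<le> D\<^sub>j\<close>, the product of the \<open>1 + u\<^sub>j\<close> is least when the \<open>u\<^sub>j\<close> with large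
  \<open>D\<^sub>j\<close> are saturated first. Peeling off the factor with smallest \<open>D\<^sub>j\<close>, a surplus there is moved
  to the next unsaturated index.\<close>

lemma saturated_prod_le:
  fixes D u :: "nat \<Rightarrow> nat"
  assumes "m \<le> p" "p \<le> n"
    and "\<And>i j. m \<le> i \<Longrightarrow> i \<le> j \<Longrightarrow> j \<le> n \<Longrightarrow> D i \<le> D j"
    and "\<And>j. m \<le> j \<Longrightarrow> j \<le> n \<Longrightarrow> u j \<le> D j"
    and "r \<le> D p"
    and "r + (\<Sum>j=Suc p..n. D j) \<le> (\<Sum>j=m..n. u j)"
  shows "(1 + r) * (\<Prod>j=Suc p..n. 1 + D j) \<le> (\<Prod>j=m..n. 1 + u j)"
proof -
  have "m \<le> n" using assms by simp
  then show ?thesis using assms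
  proof (induction m arbitrary: p r rule: inc_induct)
    case base
    then show ?case by simp
  next
    case (step m)
    let ?v = "u m"
    have S: "(\<Sum>j=m..n. u j) = ?v + (\<Sum>j=Suc m..n. u j)"
      using step.hyps by (simp add: sum.atLeast_Suc_atMost)
    have P: "(\<Prod>j=m..n. 1 + u j) = (1 + ?v) * (\<Prod>j=Suc m..n. 1 + u j)"
      using step.hyps by (simp add: prod.atLeast_Suc_atMost)
    have v: "?v \<le> D m" using step by simp
    have mono: "\<And>i j. Suc m \<le> i \<Longrightarrow> i \<le> j \<Longrightarrow> j \<le> n \<Longrightarrow> D i \<le> D j"
      and le: "\<And>j. Suc m \<le> j \<Longrightarrow> j \<le> n \<Longrightarrow> u j \<le> D j"
      using step.prems by simp_all
    show ?case
    proof (cases "r \<le> ?v")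
      case True
      show ?thesis
      proof (cases "p = n")
        case True
        have "1 \<le> (\<Prod>j=Suc m..n. 1 + u j)" by (intro prod_ge_1) simp
        then have "(1 + ?v) * 1 \<le> (1 + ?v) * (\<Prod>j=Suc m..n. 1 + u j)"
          by (rule mult_left_mono) simp
        with True \<open>r \<le> ?v\<close> show ?thesis unfolding P by simp
      next
        case False
        then have pn: "Suc p \<le> n" using step.prems by simp
        have Dp: "D m \<le> D (Suc p)" using step.prems pn by simp
        \<comment> \<open>The surplus \<open>?v - r\<close> is deducted from the saturated entry at
          \<open>Suc p\<close>. The subtraction is exact because \<open>?v\<close> is at most
          \<open>D m\<close>, hence at most \<open>D (Suc p)\<close>.\<close>
        let ?r = "D (Suc p) + r - ?v"
        have "?r + (\<Sum>j=Suc (Suc p)..n. D j) \<le> (\<Sum>j=Suc m..n. u j)"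
          using step.prems(6) S v Dp pn by (simp add: sum.atLeast_Suc_atMost)
        then have "(1 + ?r) * (\<Prod>j=Suc (Suc p)..n. 1 + D j) \<le> (\<Prod>j=Suc m..n. 1 + u j)"
          using step.prems(1) True pn mono le by (intro step.IH) auto
        then have "(1 + ?v) * ((1 + ?r) * (\<Prod>j=Suc (Suc p)..n. 1 + D j)) \<le> (\<Prod>j=m..n. 1 + u j)"
          unfolding P by (rule mult_left_mono) simp
        \<comment> \<open>Both sides have the same sum of factors, and the right pair is more
          balanced.\<close>
        moreover have "(1 + r) * (1 + D (Suc p)) \<le> (1 + ?v) * (1 + ?r)"
        proof -
          obtain x where x: "?v = r + x" using True le_Suc_ex by blast
          obtain y where y: "D (Suc p) = ?v + y" using v Dp le_Suc_ex order_trans by blast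
          have r: "?r = r + y" using y by simp
          show ?thesis unfolding r unfolding y x by (simp add: algebra_simps)
        qed
        then have "(1 + r) * (1 + D (Suc p)) * (\<Prod>j=Suc (Suc p)..n. 1 + D j)
          \<le> (1 + ?v) * (1 + ?r) * (\<Prod>j=Suc (Suc p)..n. 1 + D j)"
          by (rule mult_right_mono) simp
        moreover have "(\<Prod>j=Suc p..n. 1 + D j) = (1 + D (Suc p)) * (\<Prod>j=Suc (Suc p)..n. 1 + D j)"
          using pn by (simp add: prod.atLeast_Suc_atMost)
        ultimately show ?thesis by (simp only: mult.assoc)
      qed
    next
      case False
      \<comment> \<open>For \<open>p = m\<close> the bounds on the later \<open>u j\<close> would
        turn the sum hypothesis into \<open>r \<le> ?v\<close>.\<close>
      have "p \<noteq> m"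
      proof
        assume "p = m"
        moreover have "(\<Sum>j=Suc m..n. u j) \<le> (\<Sum>j=Suc m..n. D j)"
          using le by (intro sum_mono) simp
        ultimately show False using step.prems(6) S False by simp
      qed
      then have "Suc m \<le> p" using step.prems by simp
      then have "(1 + (r - ?v)) * (\<Prod>j=Suc p..n. 1 + D j) \<le> (\<Prod>j=Suc m..n. 1 + u j)"
        using step.prems mono le S False by (intro step.IH) auto
      then have "(1 + ?v) * ((1 + (r - ?v)) * (\<Prod>j=Suc p..n. 1 + D j)) \<le> (\<Prod>j=m..n. 1 + u j)"
        unfolding P by (rule mult_left_mono) simp
      moreover have "1 + r \<le> (1 + ?v) * (1 + (r - ?v))"
      proof -
        obtain x where "r = ?v + x" using False le_Suc_ex nat_le_linear by blast
        then show ?thesis by simp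
      qed
      then have "(1 + r) * (\<Prod>j=Suc p..n. 1 + D j)
          \<le> (1 + ?v) * (1 + (r - ?v)) * (\<Prod>j=Suc p..n. 1 + D j)"
        by (rule mult_right_mono) simp
      ultimately show ?thesis by (simp only: mult.assoc)
    qed
  qed
qed

subsection \<open>Nested cartesian sets\<close>

text \<open>The homogenization \<open>t\<^sub>1 \<Prod>\<^sub>a\<^sub>\<in>\<^sub>A (t\<^sub>j - a t\<^sub>1)\<close> vanishes on the nested set because \<open>x\<^sub>j / x\<^sub>1 \<in> A\<^sub>j\<close>;
  it forces \<open>t\<^sub>1 t\<^sub>j\<^sup>n\<close> with \<open>n = |A\<^sub>j|\<close> into the initial ideal.\<close>

lemma nested_cartesian_ideal_member:
  assumes nested: "nested_cartesian s A" and j: "j \<in> {2..s}"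
  shows "\<exists>g\<in>vanishing_ideal s (proj_cart s A). g \<noteq> 0 \<and>
    lead_mon g = Poly_Mapping.single j (card (A j)) + Poly_Mapping.single 1 1"
proof -
  define n where "n = card (A j)"
  define p where "p = (\<Prod>a\<in>A j. [:- a, 1:])"
  \<comment> \<open>Total degree \<open>n + 1\<close> rather than \<open>n\<close>: the extra factor
    t_1 kills the points with first coordinate 0, where no quotient by it exists.\<close>
  define M where "M i = Poly_Mapping.single j i + Poly_Mapping.single (1::nat) (n + 1 - i)" for i :: nat
  define H where "H = (\<Sum>i\<le>n. Poly_Mapping.single (M i) (coeff p i))"
  have fin: "finite (A j)" using nested j by (simp add: nested_cartesian_def)
  have deg: "degree p = n"
    unfolding p_def n_def by (subst degree_prod_sum_eq) auto
  have lc: "coeff p n = 1"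
    unfolding deg[symmetric] p_def lead_coeff_prod by simp
  have Mj: "Poly_Mapping.lookup (M i) j = i" for i
    using j by (simp add: M_def lookup_add lookup_single)
  have M_gt: "Poly_Mapping.lookup (M i) k = 0" if "k > j" for i k
    using that j by (simp add: M_def lookup_add lookup_single)
  have M_keys: "Poly_Mapping.keys (M i) \<subseteq> {1..s}" for i
    unfolding M_def using j
    by (intro order_trans[OF keys_add]) auto
  have H_hom: "H \<in> homog s (n + 1)"
    unfolding H_def using M_keys
    by (intro sum_in_homog single_in_homog) (auto simp: M_def mon_deg_add)
  have H_val: "peval H x = (\<Sum>i\<le>n. coeff p i * (x j ^ i * x 1 ^ (n + 1 - i)))" for x
    by (simp add: H_def peval_sum peval_single M_def mon_val_add)
  have H_vanish: "peval H x = 0" if x: "x \<in> affine_cart s A" for x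
  proof (cases "x 1 = 0")
    case True
    then show ?thesis unfolding H_val by (intro sum.neutral) auto
  next
    case False
    have "x j \<in> A j" "x 1 \<in> A 1" using x j by (auto simp: affine_cart_def)
    moreover have "\<forall>i j a b. 1 \<le> i \<and> i < j \<and> j \<le> s \<and> a \<in> A j \<and> b \<in> A i \<and> b \<noteq> 0 \<longrightarrow> a / b \<in> A j"
      using nested unfolding nested_cartesian_def by (elim conjE)
    ultimately have "x j / x 1 \<in> A j"
      using False j by (elim allE[of _ 1] allE[of _ j] allE[of _ "x j"] allE[of _ "x 1"]) auto
    then have "poly p (x j / x 1) = 0"
      using fin by (auto simp: p_def poly_prod)
    moreover have "peval H x = x 1 ^ (n + 1) * poly p (x j / x 1)"
      unfolding H_val poly_altdef deg sum_distrib_left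
    proof (rule sum.cong)
      fix i assume "i \<in> {..n}"
      then have "x 1 ^ (n + 1) = x 1 ^ i * x 1 ^ (n + 1 - i)"
        by (simp flip: power_add)
      then show "coeff p i * (x j ^ i * x 1 ^ (n + 1 - i)) = x 1 ^ (n + 1) * (coeff p i * (x j / x 1) ^ i)"
        using False by (simp add: power_divide)
    qed simp
    ultimately show ?thesis by simp
  qed
  have H_lookup: "Poly_Mapping.lookup H m = (\<Sum>i\<le>n. if M i = m then coeff p i else 0)" for m
    by (simp add: H_def lookup_sum lookup_single when_def)
  \<comment> \<open>The exponent of t_j recovers \<open>i\<close> from \<open>M i\<close>, so no
    other term merges with the leading one.\<close>
  have "(\<Sum>i\<le>n. if M i = M n then coeff p i else 0) = (\<Sum>i\<le>n. if i = n then coeff p i else 0)"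
    using Mj by (intro sum.cong refl if_cong) metis+
  then have Mn: "Poly_Mapping.lookup H (M n) = 1"
    using lc by (simp add: H_lookup)
  have "lex_max H (M n)"
    unfolding lex_max_def
  proof (intro conjI ballI impI)
    show "M n \<in> Poly_Mapping.keys H" using Mn by (simp add: in_keys_iff)
    fix m assume m: "m \<in> Poly_Mapping.keys H" "m \<noteq> M n"
    then have "(\<Sum>i\<le>n. if M i = m then coeff p i else 0) \<noteq> 0"
      by (simp only: in_keys_iff H_lookup) simp
    then obtain i where "i \<in> {..n}" "(if M i = m then coeff p i else 0) \<noteq> 0"
      by (rule sum.not_neutral_contains_not_neutral)
    then have i: "i \<le> n" "M i = m"
      by (simp_all split: if_splits)
    with m(2) have "i < n" by (cases "i = n") auto
    then show "lex_less m (M n)"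
      unfolding lex_less_def i(2)[symmetric] using Mj M_gt by (intro exI[of _ j]) simp
  qed
  then have "lead_mon H = M n" by (rule lead_mon_eqI)
  moreover have "H \<noteq> 0" using Mn by auto
  moreover have "H \<in> vanishing_ideal s (proj_cart s A)"
    using H_hom H_vanish
    by (subst vanishing_ideal_eq[OF proj_cart_def]) (auto simp: line_restr_homog homog_imp_polyS)
  ultimately show ?thesis by (auto simp: M_def n_def)
qed

lemma initial_ideal_multiple:
  assumes "g \<in> I" "g \<noteq> 0" "lead_mon g = b" "Poly_Mapping.keys m \<subseteq> {1..s}"
    and le: "\<And>i. Poly_Mapping.lookup b i \<le> Poly_Mapping.lookup m i"
  shows "mon_poly m \<in> initial_ideal s I"
proof -
  have "m = (m - b) + b"
    using le by (intro poly_mapping_eqI) (simp add: lookup_add lookup_minus)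
  then have "(mon_poly m :: 'a mpoly) = mon_poly (m - b) * mon_poly b"
    by (simp add: mon_poly_def mult_single)
  moreover have "Poly_Mapping.keys (m - b) \<subseteq> {1..s}"
    using assms(4) by (auto simp: subset_iff in_keys_iff lookup_minus)
  then have "(mon_poly (m - b) :: 'a mpoly) \<in> polyS s"
    unfolding mon_poly_def by (rule single_in_polyS)
  moreover have "mon_poly b \<in> initial_ideal s I"
    unfolding initial_ideal_def using assms(1-3) by (intro ideal_gen.gen) auto
  ultimately show ?thesis
    unfolding initial_ideal_def by (simp add: ideal_gen.mult)
qed

text \<open>Otherwise the monomial, being divisible by t_1, is a multiple of the initial monomial
  supplied by \<open>nested_cartesian_ideal_member\<close>.\<close>

lemma standard_exponent_less:
  assumes "nested_cartesian s A" "j \<in> {2..s}"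
    and std: "standard_poly s (vanishing_ideal s (proj_cart s A)) f"
    and m: "m \<in> Poly_Mapping.keys f" "Poly_Mapping.keys m \<subseteq> {1..s}" "1 \<le> Poly_Mapping.lookup m 1"
  shows "Poly_Mapping.lookup m j < card (A j)"
proof (rule ccontr)
  assume "\<not> ?thesis"
  then have le: "Poly_Mapping.lookup (Poly_Mapping.single j (card (A j)) + Poly_Mapping.single 1 1) i
      \<le> Poly_Mapping.lookup m i" for i
    using m(3) assms(2) by (auto simp: lookup_add lookup_single when_def)
  obtain g where "g \<in> vanishing_ideal s (proj_cart s A)" "g \<noteq> 0"
    "lead_mon g = Poly_Mapping.single j (card (A j)) + Poly_Mapping.single 1 1"
    using nested_cartesian_ideal_member[OF assms(1,2)] by blast
  then have "mon_poly m \<in> initial_ideal s (vanishing_ideal s (proj_cart s A))"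
    by (rule initial_ideal_multiple) (use m(2) le in auto)
  then show False using std m(1) by (simp add: standard_poly_def)
qed

text \<open>For a lower bound it suffices to count points with first coordinate 1. By truncated
  subtraction the bound is trivial when some exponent reaches \<open>card (A i)\<close>.\<close>

lemma card_nonzeros_ge:
  fixes f :: "'a::field mpoly"
  assumes nested: "nested_cartesian s A" and s: "1 \<le> s"
    and f: "f \<in> homog s d" "f \<noteq> 0" and fin: "finite (proj_cart s A)"
  shows "(\<Prod>i=2..s. card (A i) - Poly_Mapping.lookup (lead_mon f) i)
    \<le> card (proj_cart s A - zeros_in f (proj_cart s A))"
proof -
  let ?X = "proj_cart s A" and ?a = "lead_mon f"
  let ?g = "\<lambda>x. \<Sum>m\<in>Poly_Mapping.keys f. Poly_Mapping.lookup f m * (\<Prod>i=2..s. x i ^ Poly_Mapping.lookup m i)"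
  let ?N = "{x \<in> PiE {2..s} A. ?g x \<noteq> 0}"
  define emb where "emb x = (\<lambda>i. if i = 1 then 1 else if i \<in> {2..s} then x i else (0::'a))" for x
  have a: "?a \<in> Poly_Mapping.keys f" "\<forall>m\<in>Poly_Mapping.keys f. m \<noteq> ?a \<longrightarrow> lex_less m ?a"
    using lex_max_lead_mon[OF f(2)] by (simp_all add: lex_max_def)
  have keys: "Poly_Mapping.keys m \<subseteq> {1..s}" "mon_deg m = d" if "m \<in> Poly_Mapping.keys f" for m
    using f(1) that by (auto simp: homog_def polyS_def)
  have split: "{1..s} = insert 1 {2..s}" using s by auto
  have deg: "Poly_Mapping.lookup m 1 + (\<Sum>i=2..s. Poly_Mapping.lookup m i) = d"
    if "m \<in> Poly_Mapping.keys f" for m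
    using mon_deg_superset[of "{1..s}" m] keys[OF that] unfolding split by simp
  have dehom: "\<exists>i\<in>{2..s}. Poly_Mapping.lookup m i < Poly_Mapping.lookup ?a i \<and>
      (\<forall>j\<in>{2..s}. i < j \<longrightarrow> Poly_Mapping.lookup m j = Poly_Mapping.lookup ?a j)"
    if m: "m \<in> Poly_Mapping.keys f" "m \<noteq> ?a" for m
  proof -
    obtain i where i: "Poly_Mapping.lookup m i < Poly_Mapping.lookup ?a i"
      "\<forall>j>i. Poly_Mapping.lookup m j = Poly_Mapping.lookup ?a j"
      using a m by (auto simp: lex_less_def)
    then have "i \<in> Poly_Mapping.keys ?a" by (simp add: in_keys_iff)
    then have "i \<in> {1..s}" using keys(1)[OF a(1)] by blast
    \<comment> \<open>Monomials of equal degree cannot differ in t_1 alone.\<close>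
    moreover have "i \<noteq> 1"
    proof
      assume "i = 1"
      with i(2) have "(\<Sum>i=2..s. Poly_Mapping.lookup m i) = (\<Sum>i=2..s. Poly_Mapping.lookup ?a i)"
        by (intro sum.cong) auto
      with deg[OF m(1)] deg[OF a(1)] i(1) \<open>i = 1\<close> show False by simp
    qed
    ultimately show ?thesis using i by (intro bexI[of _ i]) auto
  qed
  have "(\<Prod>i=2..s. card (A i) - Poly_Mapping.lookup ?a i) \<le> card ?N"
    using nested a(1) dehom
    by (intro lex_footprint_bound) (auto simp: nested_cartesian_def in_keys_iff)
  also have "card ?N \<le> card (?X - zeros_in f ?X)"
  proof (rule card_inj_on_le)
    show "inj_on (\<lambda>x. proj_pt (emb x)) ?N"
    proof (rule inj_onI)
      fix x y assume xy: "x \<in> ?N" "y \<in> ?N" and eq: "proj_pt (emb x) = proj_pt (emb y)"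
      have "emb x \<in> proj_pt (emb x)" by (auto simp: proj_pt_def intro: exI[of _ 1])
      then obtain c where c: "emb x = (\<lambda>i. c * emb y i)" unfolding eq by (auto simp: proj_pt_def)
      \<comment> \<open>The first coordinate, normalized to 1, fixes the scalar.\<close>
      have "c = 1" using fun_cong[OF c, of 1] by (simp add: emb_def)
      with c have "emb x = emb y" by simp
      have "x i = y i" if "i \<in> {2..s}" for i
        using fun_cong[OF \<open>emb x = emb y\<close>, of i] that by (auto simp: emb_def)
      then show "x = y" using xy by (intro PiE_ext[of x "{2..s}" A y]) auto
    qed
    show "(\<lambda>x. proj_pt (emb x)) ` ?N \<subseteq> ?X - zeros_in f ?X"
    proof (intro image_subsetI DiffI)
      fix x assume x: "x \<in> ?N"
      have "1 \<in> A 1" using nested s by (auto simp: nested_cartesian_def)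
      then have "emb x \<in> affine_cart s A"
        using x s by (auto simp: emb_def affine_cart_def PiE_def)
      moreover have "emb x 1 \<noteq> 0" by (simp add: emb_def)
      then have "emb x \<noteq> (\<lambda>_. 0)" by (metis (full_types))
      ultimately show "proj_pt (emb x) \<in> ?X" by (simp add: proj_cart_def)
      have "mon_val (emb x) m = (\<Prod>i=2..s. x i ^ Poly_Mapping.lookup m i)"
        if "m \<in> Poly_Mapping.keys f" for m
      proof -
        have "mon_val (emb x) m = (\<Prod>i=2..s. emb x i ^ Poly_Mapping.lookup m i)"
          using mon_val_superset[of "{1..s}" m "emb x"] keys[OF that] unfolding split
          by (simp add: emb_def)
        also have "\<dots> = (\<Prod>i=2..s. x i ^ Poly_Mapping.lookup m i)"
          by (intro prod.cong) (auto simp: emb_def)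
        finally show ?thesis .
      qed
      then have "peval f (emb x) = ?g x" by (simp add: peval_eq)
      moreover have "emb x \<in> proj_pt (emb x)" by (auto simp: proj_pt_def intro: exI[of _ 1])
      ultimately show "proj_pt (emb x) \<notin> zeros_in f ?X"
        using x unfolding zeros_in_def by force
    qed
    show "finite (?X - zeros_in f ?X)" using fin by simp
  qed
  finally show ?thesis .
qed

lemma finite_affine_cart: "finite (affine_cart s (A :: nat \<Rightarrow> 'a::{finite,field} set))"
proof -
  have "finite {x. \<forall>i. (i \<in> {1..s} \<longrightarrow> x i \<in> (UNIV :: 'a set)) \<and> (i \<notin> {1..s} \<longrightarrow> x i = 0)}"
    by (rule finite_set_of_finite_funs) auto
  then show ?thesis
    by (rule finite_subset[rotated]) (auto simp: affine_cart_def)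
qed

theorem theorem6p6:
  fixes A :: "nat \<Rightarrow> 'a::{finite,field} set"
    and s d k l :: nat
    and f :: "'a mpoly"
  assumes nested: "nested_cartesian s A"
    and f_hom: "f \<in> homog s d"
    and f_nz: "f \<noteq> 0"
    and f_std: "standard_poly s (vanishing_ideal s (proj_cart s A)) f"
    and d_ge: "1 \<le> d"
    and d_le: "d \<le> (\<Sum>i=2..s. card (A i) - 1)"
    and t1_dvd: "1 \<le> Poly_Mapping.lookup (lead_mon f) 1"
    and k_le: "k \<le> s - 2"
    and d_eq: "d = (\<Sum>i=2..k+1. card (A i) - 1) + l"
    and l_ge: "1 \<le> l"
    and l_le: "l \<le> card (A (k+2)) - 1"
  shows "real (card (zeros_in f (proj_cart s A)))
           \<le> deg_quot s (vanishing_ideal s (proj_cart s A))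
              - real ((card (A (k+2)) - l + 1) * (\<Prod>i=k+3..s. card (A i)))"
proof -
  let ?X = "proj_cart s A" and ?a = "Poly_Mapping.lookup (lead_mon f)"
  let ?D = "\<lambda>i. card (A i) - 1"
  \<comment> \<open>For smaller \<open>s\<close> the sum bounding \<open>d\<close> is empty.\<close>
  have s2: "2 \<le> s"
    using d_ge d_le by (cases "2 \<le> s") auto
  then have ks: "k + 2 \<le> s" using k_le by simp
  have card_pos: "1 \<le> card (A i)" and fin: "finite (A i)" if "i \<in> {1..s}" for i
  proof -
    have A: "finite (A i)" "0 \<in> A i" using nested that by (auto simp: nested_cartesian_def)
    then show "finite (A i)" "1 \<le> card (A i)" by (auto simp: Suc_le_eq card_gt_0_iff)
  qed
  have a: "lead_mon f \<in> Poly_Mapping.keys f"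
    using lex_max_lead_mon[OF f_nz] by (simp add: lex_max_def)
  have a_keys: "Poly_Mapping.keys (lead_mon f) \<subseteq> {1..s}" and a_deg: "mon_deg (lead_mon f) = d"
    using f_hom a by (auto simp: homog_def polyS_def)
  have a_less: "?a j < card (A j)" if "j \<in> {2..s}" for j
    using standard_exponent_less[OF nested that f_std a a_keys t1_dvd] .
  have "{1..s} = insert 1 {2..s}" using s2 by auto
  then have a_sum: "?a 1 + (\<Sum>i=2..s. ?a i) = d"
    using mon_deg_superset[of "{1..s}" "lead_mon f"] a_keys a_deg by simp
  have bound: "(card (A (k+2)) - l + 1) * (\<Prod>i=k+3..s. card (A i)) \<le> (\<Prod>i=2..s. card (A i) - ?a i)"
  proof -
    \<comment> \<open>\<open>1 + ?u i\<close> is the factor \<open>card (A i) - ?a i\<close>, and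
      \<open>?r\<close> equals \<open>?D (k+2) - (l - 1)\<close>.\<close>
    let ?u = "\<lambda>i. ?D i - ?a i" and ?r = "card (A (k+2)) - l"
    have "(\<Sum>i=2..s. ?u i) + (\<Sum>i=2..s. ?a i) = (\<Sum>i=2..s. ?D i)"
      unfolding sum.distrib[symmetric] using a_less by (intro sum.cong) force+
    moreover have "{2..s} = {2..k+1} \<union> {k+2..s}" "{2..k+1} \<inter> {k+2..s} = {}" using ks by auto
    then have "(\<Sum>i=2..s. ?D i) = (\<Sum>i=2..k+1. ?D i) + (\<Sum>i=k+2..s. ?D i)"
      by (simp only: sum.union_disjoint finite_atLeastAtMost)
    moreover have "(\<Sum>i=k+2..s. ?D i) = ?D (k+2) + (\<Sum>i=Suc (k+2)..s. ?D i)"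
      using ks by (rule sum.atLeast_Suc_atMost)
    \<comment> \<open>As t_1 takes at least one degree, the other exponents sum to at most
      \<open>d - 1\<close>; this unit is the \<open>+ 1\<close> in the final bound.\<close>
    ultimately have budget: "?r + (\<Sum>i=Suc (k+2)..s. ?D i) \<le> (\<Sum>i=2..s. ?u i)"
      using a_sum d_eq t1_dvd l_le l_ge by linarith
    have "(1 + ?r) * (\<Prod>i=Suc (k+2)..s. 1 + ?D i) \<le> (\<Prod>i=2..s. 1 + ?u i)"
    proof (rule saturated_prod_le[OF _ ks])
      show "?D i \<le> ?D j" if "2 \<le> i" "i \<le> j" "j \<le> s" for i j
      proof -
        have "card (A i) \<le> card (A j)" using nested that by (simp add: nested_cartesian_def)
        then show ?thesis by (rule diff_le_mono)
      qed
    qed (use budget l_ge in auto)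
    moreover have "(\<Prod>i=Suc (k+2)..s. 1 + ?D i) = (\<Prod>i=k+3..s. card (A i))"
    proof (rule prod.cong)
      fix i assume "i \<in> {k+3..s}"
      then show "1 + ?D i = card (A i)" using card_pos[of i] by simp
    qed (simp add: numeral_3_eq_3)
    moreover have "(\<Prod>i=2..s. 1 + ?u i) = (\<Prod>i=2..s. card (A i) - ?a i)"
      using a_less by (intro prod.cong) force+
    ultimately show ?thesis by simp
  qed
  have X: "?X = proj_pt ` (affine_cart s A - {\<lambda>_. 0})" by (rule proj_cart_def)
  have finX: "finite ?X" unfolding X by (simp add: finite_affine_cart)
  have deg: "deg_quot s (vanishing_ideal s ?X) = real (card ?X)"
  proof (rule deg_quot_vanishing_ideal[OF X])
    \<comment> \<open>The point (1, ..., 1) shows that the set is nonempty.\<close>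
    have "(\<lambda>i. if i \<in> {1..s} then 1 else 0) \<in> affine_cart s A - {\<lambda>_. 0}"
      using nested s2 by (auto simp: affine_cart_def nested_cartesian_def fun_eq_iff intro!: exI[of _ 1])
    then show "affine_cart s A - {\<lambda>_. 0} \<noteq> {}" by blast
  next
    show "finite (affine_cart s A - {\<lambda>_. 0})" by (simp add: finite_affine_cart)
  qed (auto simp: affine_cart_def)
  have sub: "zeros_in f ?X \<subseteq> ?X" by (auto simp: zeros_in_def)
  have "(card (A (k+2)) - l + 1) * (\<Prod>i=k+3..s. card (A i)) \<le> card (?X - zeros_in f ?X)"
    using bound card_nonzeros_ge[OF nested _ f_hom f_nz finX] s2 by linarith
  also have "\<dots> = card ?X - card (zeros_in f ?X)"
    using sub finX by (intro card_Diff_subset) (auto intro: finite_subset)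
  finally have "(card (A (k+2)) - l + 1) * (\<Prod>i=k+3..s. card (A i)) + card (zeros_in f ?X) \<le> card ?X"
    using card_mono[OF finX sub] by linarith
  then have "real ((card (A (k+2)) - l + 1) * (\<Prod>i=k+3..s. card (A i))) + real (card (zeros_in f ?X))
      \<le> real (card ?X)"
    by (simp only: of_nat_add[symmetric] of_nat_le_iff)
  then show ?thesis unfolding deg by linarith
qed

end
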